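(* Let $p>1$. For any $\delta>0$ (and every integer $n\ge2$), there exists some random probability mass function $\tilde f$ on $\mathbb{Z}_+$, measurable with respect to $Y^n$, such that $$\sup_{G\in\mathcal{G}_p(1)}\mathbb{E}_GH^2(\tilde f,f_G)\le C\,n^{-\frac{2p}{2p+1}}(\log n)^6,$$ and the resulting $f$-modeling estimator $\tilde\theta_n=(Y_n+1)\dfrac{\tilde f(Y_n+1)}{\tilde f(Y_n)}$ satisfies $$\mathsf{Regret}_n\big(\tilde\theta_n;\mathcal{G}_p(1)\big)\ge c\,\frac{n^{-\frac{2p-3}{2p+1}-\delta}}{(\log n)^4},$$ where $C,c>0$ depend only on $p$.
   Context: $\mathbb{R}_+=[0,\infty)$, $\mathbb{Z}_+=\{0,1,2,\ldots\}$. $\mathcal{G}_p(1)$ is the set of Borel probability measures $G$ on $\mathbb{R}_+$ with $\int u^pG(du)\le1$. $f_G(y)=\int\frac{e^{-\theta}\theta^y}{y!}G(d\theta)$ is the Poisson mixture. $H^2(f,g)=\sum_{y\ge0}(\sqrt{f(y)}-\sqrt{g(y)})^2$. Poisson empirical Bayes model with prior $G$: $\theta_1,\ldots,\theta_n$ i.i.d. from $G$ and, given them, $Y_i\sim\mathrm{Poi}(\theta_i)$ independently, so that $Y^n=(Y_1,\ldots,Y_n)$ is i.i.d. from $f_G$. The Bayes risk is $\mathsf{mmse}(G)=\mathbb{E}_G(\mathbb{E}_G[\theta\mid Y]-\theta)^2$ with $\theta\sim G$, $Y\mid\theta\sim\mathrm{Poi}(\theta)$, and the individual regret of an estimator $\hat\theta$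 of $\theta_n$ is $\mathsf{Regret}_n(\hat\theta;\mathcal{G})=\sup_{G\in\mathcal{G}}\{\mathbb{E}_G(\hat\theta(Y^n)-\theta_n)^2-\mathsf{mmse}(G)\}$. *)

theory Defs
  imports "HOL-Probability.Probability"
begin

text \<open>Borel probability measures on \<open>[0,\<infinity>)\<close> are represented as probability measures on the
  Borel sets of \<open>real\<close> that give full mass to \<open>{0..}\<close>.\<close>

definition prior_class :: "real \<Rightarrow> real measure set" where
  "prior_class p = {G. prob_space G \<and> sets G = sets borel \<and> emeasure G {0..} = 1 \<and>
     (\<integral>\<^sup>+u. ennreal (u powr p) \<partial>G) \<le> 1}"

text \<open>Written out because the library's \<open>poisson_pmf\<close> is specified only for a positive rate,
  whereas a prior may charge \<open>0\<close>; since \<open>0 ^ 0 = 1\<close>, rate \<open>0\<close> gives the point mass at \<open>0\<close>.\<close>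

definition poisson_lik :: "real \<Rightarrow> nat \<Rightarrow> real" where
  "poisson_lik \<theta> y = exp (- \<theta>) * \<theta> ^ y / fact y"

definition poisson_mixture :: "real measure \<Rightarrow> nat \<Rightarrow> real" where
  "poisson_mixture G y = (\<integral>\<theta>. poisson_lik \<theta> y \<partial>G)"

definition hellinger_sq :: "(nat \<Rightarrow> real) \<Rightarrow> (nat \<Rightarrow> real) \<Rightarrow> real" where
  "hellinger_sq f g = (\<Sum>y. (sqrt (f y) - sqrt (g y))\<^sup>2)"

text \<open>Joint law of \<open>(\<theta>, Y)\<close> with \<open>\<theta> \<sim> G\<close> and \<open>Y | \<theta> \<sim> Poi(\<theta>)\<close>.\<close>

definition poisson_joint :: "real measure \<Rightarrow> (real \<times> nat) measure" where
  "poisson_joint G =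
     density (G \<Otimes>\<^sub>M count_space UNIV) (\<lambda>(\<theta>, y). ennreal (poisson_lik \<theta> y))"

text \<open>Joint law of \<open>(\<theta>\<^sub>i, Y\<^sub>i)\<close>, \<open>i = 1, \<dots>, n\<close>; a sample point is a function on \<open>{1..n}\<close>.\<close>

definition eb_model :: "nat \<Rightarrow> real measure \<Rightarrow> (nat \<Rightarrow> real \<times> nat) measure" where
  "eb_model n G = Pi\<^sub>M {1..n} (\<lambda>_. poisson_joint G)"

definition observations :: "nat \<Rightarrow> (nat \<Rightarrow> real \<times> nat) \<Rightarrow> nat \<Rightarrow> nat" where
  "observations n \<omega> = (\<lambda>i\<in>{1..n}. snd (\<omega> i))"

definition observation_space :: "nat \<Rightarrow> (nat \<Rightarrow> nat) measure" where
  "observation_space n = Pi\<^sub>M {1..n} (\<lambda>_. count_space UNIV)"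

definition posterior_mean :: "real measure \<Rightarrow> real \<times> nat \<Rightarrow> real" where
  "posterior_mean G =
     real_cond_exp (poisson_joint G)
       (vimage_algebra (space (poisson_joint G)) snd (count_space UNIV)) fst"

text \<open>Risks are \<open>ennreal\<close>-valued, since the squared error of an estimator need not be integrable.
  The Bayes risk is at most \<open>\<integral>\<theta> dG\<close>, hence finite on \<open>prior_class p\<close> for \<open>p \<ge> 1\<close>, so that the
  difference in \<open>regret\<close> is not of the form \<open>\<infinity> - \<infinity>\<close>.\<close>

definition mmse :: "real measure \<Rightarrow> ennreal" where
  "mmse G = (\<integral>\<^sup>+z. ennreal ((posterior_mean G z - fst z)\<^sup>2) \<partial>poisson_joint G)"

definition risk :: "nat \<Rightarrow> ((nat \<Rightarrow> nat) \<Rightarrow> real) \<Rightarrow> real measure \<Rightarrow> ennreal" where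
  "risk n est G =
     (\<integral>\<^sup>+\<omega>. ennreal ((est (observations n \<omega>) - fst (\<omega> n))\<^sup>2) \<partial>eb_model n G)"

definition regret :: "nat \<Rightarrow> ((nat \<Rightarrow> nat) \<Rightarrow> real) \<Rightarrow> real measure set \<Rightarrow> ereal" where
  "regret n est \<G> = (SUP G\<in>\<G>. enn2ereal (risk n est G) - enn2ereal (mmse G))"

definition hellinger_risk ::
    "nat \<Rightarrow> ((nat \<Rightarrow> nat) \<Rightarrow> nat pmf) \<Rightarrow> real measure \<Rightarrow> ennreal" where
  "hellinger_risk n ft G =
     (\<integral>\<^sup>+\<omega>. ennreal (hellinger_sq (pmf (ft (observations n \<omega>))) (poisson_mixture G)) \<partial>eb_model n G)"

text \<open>A random probability mass function that is a measurable function of the observations.\<close>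

definition random_pmf :: "nat \<Rightarrow> ((nat \<Rightarrow> nat) \<Rightarrow> nat pmf) \<Rightarrow> bool" where
  "random_pmf n ft \<longleftrightarrow> (\<forall>k. (\<lambda>y. pmf (ft y) k) \<in> borel_measurable (observation_space n))"

definition f_modeling :: "nat \<Rightarrow> ((nat \<Rightarrow> nat) \<Rightarrow> nat pmf) \<Rightarrow> (nat \<Rightarrow> nat) \<Rightarrow> real" where
  "f_modeling n ft y = (real (y n) + 1) * (pmf (ft y) (y n + 1) / pmf (ft y) (y n))"

text \<open>The denominator of the \<open>f\<close>-modeling estimator is nonzero at every possible sample, so that
  the convention \<open>x / 0 = 0\<close> plays no role.\<close>

definition f_modeling_well_defined :: "nat \<Rightarrow> ((nat \<Rightarrow> nat) \<Rightarrow> nat pmf) \<Rightarrow> bool" where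
  "f_modeling_well_defined n ft \<longleftrightarrow> (\<forall>y\<in>space (observation_space n). pmf (ft y) (y n) \<noteq> 0)"

end

theory Submission
  imports Defs "HOL-Library.Discrete_Functions"
begin

text \<open>
  On the square-root scale a Poisson likelihood is concentrated in a window of constant width, and
  on the blocks \<open>k / D \<le> \<surd>y < (k + 1) / D\<close> with \<open>D \<asymp> log n\<close> every Poisson mixture is, up to an
  error \<open>n\<^sup>-\<^sup>2\<close>, a fixed weight times a polynomial of degree \<open>O(log n)\<close>, and has oscillation bounded
  by a constant factor. Projecting the empirical frequencies of each block orthogonally onto these
  functions leaves a Hellinger error of \<open>O(log n / n)\<close> per block. Blocks are used for
  \<open>y < N \<asymp> n\<^bsup>2/(2p+1)\<^esup>\<close>, so that there are \<open>O(\<surd>N log n)\<close> of them, and the mass beyond \<open>N\<close> is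
  \<open>O(N\<^bsup>-p\<^esup>)\<close>, which is of the same order as \<open>\<surd>N / n\<close>.

  The Hellinger distance does not see how the tiny mass beyond \<open>N\<close> is distributed. Hence the ratio
  of the estimate at \<open>N + 1\<close> and \<open>N\<close> can be made as large as desired, and under the point mass at
  \<open>1\<close>, whose Bayes risk is \<open>0\<close>, the event \<open>Y\<^sub>n = N\<close> alone makes the regret exceed any bound.
\<close>

text \<open>Near \<open>y\<close> the Hellinger loss is a squared error divided by the mixture
  itself, and a moment bound leaves the mixture free to be arbitrarily small. Raw frequencies would
  pay about \<open>1 / n\<close> for every point below \<open>N\<close>, that is
  \<open>N / n\<close>, while only \<open>\<surd>N / n\<close> up to logarithms is affordable; a
  projection of rank \<open>m\<close> pays about \<open>m / n\<close> for a whole block, however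
  many points it contains. Low dimension of a block controls the bias; bounded oscillation lets an
  unweighted projection, which does not depend on the prior, serve a loss weighted by the unknown
  \<open>1 / f\<close>. A threshold \<open>\<tau> = n^-2\<close>, the size of the approximation
  error, is added to \<open>f\<close> in this weight to cover points where \<open>f\<close> is tiny.
  Equating \<open>\<surd>N / n\<close> with \<open>N^-p\<close> is what fixes \<open>N\<close>. The
  argument itself loses two logarithms, one in the number of blocks and one in the rank.

  Kernel and cutoff are fixed before the factor that distorts the ratio at \<open>N\<close>, and
  this factor enters the Hellinger bound only through being at most 1. It may therefore be chosen
  last, against any prescribed value of the regret, so that \<open>c = 1\<close> suffices.\<close>

section \<open>Orthogonal projection kernels on a finite set\<close>

text \<open>Gram-Schmidt, one function at a time: \<open>r\<close> is the part of \<open>e m\<close>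
  that the current kernel misses, and \<open>P'\<close> adds the rank-one projection onto it. Each
  step raises the trace by one or, for a dependent \<open>e m\<close>, by nothing, hence the
  inequality. Explicit matrix entries are kept because they are averaged over the sample
  later.\<close>

lemma projection_kernel_exists:
  fixes e :: "nat \<Rightarrow> 'a \<Rightarrow> real"
  assumes "finite B"
  shows "\<exists>P. (\<forall>y\<in>B. \<forall>z\<in>B. P y z = P z y) \<and>
    (\<forall>y\<in>B. \<forall>w\<in>B. (\<Sum>z\<in>B. P y z * P z w) = P y w) \<and>
    (\<forall>j<m. \<forall>y\<in>B. (\<Sum>z\<in>B. P y z * e j z) = e j y) \<and> (\<Sum>y\<in>B. P y y) \<le> real m"
proof (induction m)
  case 0
  show ?case by (rule exI[of _ "\<lambda>_ _. 0"]) simp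
next
  case (Suc m)
  then obtain P where sym: "\<And>y z. y \<in> B \<Longrightarrow> z \<in> B \<Longrightarrow> P y z = P z y"
    and idem: "\<And>y w. y \<in> B \<Longrightarrow> w \<in> B \<Longrightarrow> (\<Sum>z\<in>B. P y z * P z w) = P y w"
    and rep: "\<And>j y. j < m \<Longrightarrow> y \<in> B \<Longrightarrow> (\<Sum>z\<in>B. P y z * e j z) = e j y"
    and tr: "(\<Sum>y\<in>B. P y y) \<le> real m" by blast
  define q where "q y = (\<Sum>z\<in>B. P y z * e m z)" for y
  define r where "r y = e m y - q y" for y
  define s where "s = (\<Sum>y\<in>B. (r y)\<^sup>2)"
  have Pq: "(\<Sum>z\<in>B. P y z * q z) = q y" if "y \<in> B" for y
  proof -
    have "(\<Sum>z\<in>B. P y z * q z) = (\<Sum>w\<in>B. (\<Sum>z\<in>B. P y z * P z w) * e m w)"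
      unfolding q_def sum_distrib_left sum_distrib_right
      by (subst sum.swap) (simp add: mult.assoc)
    also have "\<dots> = q y" unfolding q_def using idem that by simp
    finally show ?thesis .
  qed
  have Pr: "(\<Sum>z\<in>B. P y z * r z) = 0" if "y \<in> B" for y
    using Pq[OF that] by (simp add: r_def q_def right_diff_distrib sum_subtractf)
  have rP: "(\<Sum>z\<in>B. r z * P z y) = 0" if "y \<in> B" for y
    using Pr[OF that] sym that by (simp add: mult.commute cong: sum.cong)
  have re: "(\<Sum>z\<in>B. r z * e j z) = 0" if "j < m" for j
  proof -
    have "(\<Sum>z\<in>B. r z * e j z) = (\<Sum>z\<in>B. r z * (\<Sum>w\<in>B. P z w * e j w))"
      using rep[OF that] by simp
    also have "\<dots> = (\<Sum>w\<in>B. (\<Sum>z\<in>B. r z * P z w) * e j w)"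
      unfolding sum_distrib_left sum_distrib_right by (subst sum.swap) (simp add: mult.assoc)
    also have "\<dots> = 0" using rP by simp
    finally show ?thesis .
  qed
  have rq: "(\<Sum>z\<in>B. r z * q z) = 0"
  proof -
    have "(\<Sum>z\<in>B. r z * q z) = (\<Sum>w\<in>B. (\<Sum>z\<in>B. r z * P z w) * e m w)"
      unfolding q_def sum_distrib_left sum_distrib_right by (subst sum.swap) (simp add: mult.assoc)
    also have "\<dots> = 0" using rP by simp
    finally show ?thesis .
  qed
  have "(\<Sum>z\<in>B. r z * e m z) = (\<Sum>z\<in>B. r z * r z + r z * q z)"
    by (intro sum.cong) (auto simp: r_def algebra_simps)
  then have rm: "(\<Sum>z\<in>B. r z * e m z) = s"
    using rq by (simp add: s_def sum.distrib power2_eq_square)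
  show ?case
  proof (cases "s = 0")
    case True
    then have "\<forall>y\<in>B. r y = 0"
      using assms by (simp add: s_def sum_nonneg_eq_0_iff)
    then have "(\<Sum>z\<in>B. P y z * e m z) = e m y" if "y \<in> B" for y
      using that by (simp add: r_def q_def)
    then show ?thesis
      using sym idem rep tr by (intro exI[of _ P]) (auto simp: less_Suc_eq)
  next
    case False
    define P' where "P' y z = P y z + r y * r z / s" for y z
    have "(\<Sum>z\<in>B. P' y z * P' z w) = P' y w" if "y \<in> B" "w \<in> B" for y w
    proof -
      have "(\<Sum>z\<in>B. P' y z * P' z w) = (\<Sum>z\<in>B. P y z * P z w + (P y z * r z) * (r w / s)
          + (r y / s) * (r z * P z w) + (r y * r w / s / s) * (r z)\<^sup>2)"
        by (intro sum.cong) (auto simp: P'_def algebra_simps add_divide_distrib power2_eq_square)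
      also have "\<dots> = P y w + 0 + 0 + (r y * r w / s / s) * s"
        unfolding sum.distrib sum_distrib_left[symmetric] sum_distrib_right[symmetric]
          Pr[OF that(1)] rP[OF that(2)] idem[OF that] s_def[symmetric] by simp
      finally show ?thesis using False by (simp add: P'_def)
    qed
    moreover have P'e: "(\<Sum>z\<in>B. P' y z * e j z) =
        (\<Sum>z\<in>B. P y z * e j z) + (r y / s) * (\<Sum>z\<in>B. r z * e j z)" for y j
      by (simp add: P'_def ring_distribs sum.distrib sum_distrib_left mult.assoc)
    have "(\<Sum>z\<in>B. P' y z * e j z) = e j y" if "j < Suc m" "y \<in> B" for j y
    proof (cases "j = m")
      case True
      then show ?thesis using False unfolding P'e True rm by (simp add: r_def q_def)
    next
      case neq: False
      then have "j < m" using that by simp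
      then show ?thesis unfolding P'e re[OF \<open>j < m\<close>] using rep that by simp
    qed
    moreover have "(\<Sum>y\<in>B. P' y y) = (\<Sum>y\<in>B. P y y) + s / s"
      by (simp add: P'_def sum.distrib s_def power2_eq_square flip: sum_divide_distrib)
    moreover have "P' y z = P' z y" if "y \<in> B" "z \<in> B" for y z
      using sym that by (simp add: P'_def mult.commute)
    ultimately show ?thesis using tr False by (intro exI[of _ P']) auto
  qed
qed

text \<open>The squared Frobenius norm of an orthogonal projection is its trace. Sums of squared
  entries govern the variance of projected frequencies, so the rank bounds the variance.\<close>

lemma projection_kernel_sum_squares:
  fixes P :: "'a \<Rightarrow> 'a \<Rightarrow> real"
  assumes "\<And>y z. y \<in> B \<Longrightarrow> z \<in> B \<Longrightarrow> P y z = P z y"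
    and "\<And>y w. y \<in> B \<Longrightarrow> w \<in> B \<Longrightarrow> (\<Sum>z\<in>B. P y z * P z w) = P y w"
  shows "(\<Sum>y\<in>B. \<Sum>z\<in>B. (P y z)\<^sup>2) = (\<Sum>y\<in>B. P y y)"
proof (rule sum.cong)
  fix y assume y: "y \<in> B"
  have "(\<Sum>z\<in>B. (P y z)\<^sup>2) = (\<Sum>z\<in>B. P y z * P z y)"
    using assms(1) y by (intro sum.cong) (auto simp: power2_eq_square)
  then show "(\<Sum>z\<in>B. (P y z)\<^sup>2) = P y y" using assms(2) y by simp
qed simp

text \<open>\<open>P\<close> fixes \<open>q\<close>, so \<open>P f - f = P g - g\<close> with
  \<open>g = f - q\<close>, and Pythagoras gives \<open>|P g - g|^2 = |g|^2 - |P g|^2\<close>. Any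
  comparison function fixed by \<open>P\<close> thus bounds the bias; none has to be known.\<close>

lemma projection_kernel_residual:
  fixes P :: "'a \<Rightarrow> 'a \<Rightarrow> real"
  assumes sym: "\<And>y z. y \<in> B \<Longrightarrow> z \<in> B \<Longrightarrow> P y z = P z y"
    and idem: "\<And>y w. y \<in> B \<Longrightarrow> w \<in> B \<Longrightarrow> (\<Sum>z\<in>B. P y z * P z w) = P y w"
    and q: "\<And>y. y \<in> B \<Longrightarrow> (\<Sum>z\<in>B. P y z * q z) = q y"
  shows "(\<Sum>y\<in>B. ((\<Sum>z\<in>B. P y z * f z) - f y)\<^sup>2) \<le> (\<Sum>y\<in>B. (f y - q y)\<^sup>2)"
proof -
  define g where "g y = f y - q y" for y
  define h where "h y = (\<Sum>z\<in>B. P y z * g z)" for y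
  have "(\<Sum>y\<in>B. (h y)\<^sup>2) = (\<Sum>y\<in>B. \<Sum>z\<in>B. h y * (P y z * g z))"
    by (simp add: h_def power2_eq_square sum_distrib_left)
  also have "\<dots> = (\<Sum>z\<in>B. g z * (\<Sum>y\<in>B. P z y * h y))"
    using sym by (subst sum.swap) (auto simp: sum_distrib_left mult_ac intro!: sum.cong)
  also have "\<dots> = (\<Sum>z\<in>B. g z * h z)"
  proof (intro sum.cong refl arg_cong2[where f="(*)"])
    fix z assume z: "z \<in> B"
    have "(\<Sum>y\<in>B. P z y * h y) = (\<Sum>w\<in>B. (\<Sum>y\<in>B. P z y * P y w) * g w)"
      unfolding h_def sum_distrib_left sum_distrib_right by (subst sum.swap) (simp add: mult.assoc)
    then show "(\<Sum>y\<in>B. P z y * h y) = h z" using idem z by (simp add: h_def)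
  qed
  finally have hh: "(\<Sum>y\<in>B. (h y)\<^sup>2) = (\<Sum>z\<in>B. g z * h z)" .
  have "(\<Sum>y\<in>B. ((\<Sum>z\<in>B. P y z * f z) - f y)\<^sup>2) = (\<Sum>y\<in>B. (h y - g y)\<^sup>2)"
    using q by (intro sum.cong) (auto simp: h_def g_def right_diff_distrib sum_subtractf)
  also have "\<dots> = (\<Sum>y\<in>B. (h y)\<^sup>2 + (g y)\<^sup>2 - 2 * (g y * h y))"
    by (intro sum.cong) (auto simp: power2_diff mult_ac)
  also have "\<dots> = (\<Sum>y\<in>B. (g y)\<^sup>2) - (\<Sum>y\<in>B. (h y)\<^sup>2)"
    unfolding sum_subtractf sum.distrib sum_distrib_left[symmetric] using hh by simp
  also have "\<dots> \<le> (\<Sum>y\<in>B. (g y)\<^sup>2)" by (simp add: sum_nonneg)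
  finally show ?thesis by (simp add: g_def)
qed

section \<open>Hellinger distance\<close>

text \<open>\<open>\<tau>\<close> regularises the usual bound \<open>(a - b)^2 / b\<close>, which
  degenerates for small \<open>b\<close>. For \<open>b \<ge> \<tau>\<close> it is that bound with
  \<open>b + \<tau> \<le> 2 * b\<close>; below \<open>\<tau>\<close> the estimate
  \<open>(sqrt a - sqrt b)^2 \<le> |a - b|\<close> is split by the inequality of means. Truncating
  at 0 only moves \<open>x\<close> closer to \<open>b\<close>.\<close>

lemma sqrt_diff_sq_le:
  fixes x b \<tau> :: real
  assumes "b \<ge> 0" "\<tau> > 0"
  shows "(sqrt (max 0 x) - sqrt b)\<^sup>2 \<le> 2 * (x - b)\<^sup>2 / (b + \<tau>) + \<tau>"
proof -
  define a where "a = max 0 x"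
  have a: "a \<ge> 0" by (simp add: a_def)
  have ab: "(a - b)\<^sup>2 \<le> (x - b)\<^sup>2"
    using assms by (intro abs_le_square_iff[THEN iffD1]) (auto simp: a_def)
  have sq: "(sqrt a - sqrt b) * (sqrt a + sqrt b) = a - b"
    using a assms by (simp add: algebra_simps)
  have "(sqrt a - sqrt b)\<^sup>2 * (b + \<tau>) \<le> 2 * (a - b)\<^sup>2 + \<tau> * (b + \<tau>)"
  proof (cases "b \<ge> \<tau>")
    case True
    have "(sqrt a - sqrt b)\<^sup>2 * b \<le> (sqrt a - sqrt b)\<^sup>2 * (sqrt a + sqrt b)\<^sup>2"
      using a assms by (intro mult_left_mono) (auto simp: power2_sum)
    also have "\<dots> = (a - b)\<^sup>2" using sq by (simp flip: power_mult_distrib)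
    finally have "(sqrt a - sqrt b)\<^sup>2 * b \<le> (a - b)\<^sup>2" .
    moreover have "(sqrt a - sqrt b)\<^sup>2 * \<tau> \<le> (sqrt a - sqrt b)\<^sup>2 * b"
      using True by (intro mult_left_mono) auto
    ultimately show ?thesis using assms
      by (auto simp: distrib_left intro: add_increasing2)
  next
    case False
    have "0 \<le> sqrt a" "0 \<le> sqrt b" using a assms by auto
    then have "\<bar>sqrt a - sqrt b\<bar> * \<bar>sqrt a - sqrt b\<bar> \<le> \<bar>sqrt a - sqrt b\<bar> * \<bar>sqrt a + sqrt b\<bar>"
      by (intro mult_left_mono) linarith+
    then have "(sqrt a - sqrt b)\<^sup>2 \<le> \<bar>sqrt a - sqrt b\<bar> * \<bar>sqrt a + sqrt b\<bar>"
      by (simp add: power2_eq_square)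
    also have "\<dots> = \<bar>a - b\<bar>" using sq by (simp flip: abs_mult)
    finally have 1: "(sqrt a - sqrt b)\<^sup>2 \<le> \<bar>a - b\<bar>" .
    define d where "d = \<bar>a - b\<bar>"
    define T where "T = b + \<tau>"
    have T: "0 < T" "T \<le> 2 * \<tau>" using False assms by (auto simp: T_def)
    have "d * T \<le> 2 * d\<^sup>2 + \<tau> * T"
    proof -
      have "0 \<le> (2 * d - T)\<^sup>2" by simp
      then have "4 * (d * T) \<le> 4 * d\<^sup>2 + T * T" by (simp add: power2_eq_square algebra_simps)
      moreover have "T * T \<le> 2 * \<tau> * T" using T by (intro mult_right_mono) auto
      moreover have "0 \<le> d\<^sup>2" "0 \<le> \<tau> * T" using T assms by auto
      ultimately show ?thesis by linarith
    qed
    moreover have "(sqrt a - sqrt b)\<^sup>2 * T \<le> d * T"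
      using 1 T by (intro mult_right_mono) (auto simp: d_def)
    ultimately show ?thesis by (simp add: d_def T_def)
  qed
  also have "\<dots> \<le> 2 * (x - b)\<^sup>2 + \<tau> * (b + \<tau>)" using ab by simp
  finally have "(sqrt a - sqrt b)\<^sup>2 \<le> (2 * (x - b)\<^sup>2 + \<tau> * (b + \<tau>)) / (b + \<tau>)"
    using assms by (subst pos_le_divide_eq) auto
  then show ?thesis using assms by (simp add: a_def add_divide_distrib)
qed

lemma sqrt_add_diff_sq_le:
  fixes x \<eta> b :: real
  assumes "x \<ge> 0" "\<eta> \<ge> 0"
  shows "(sqrt (x + \<eta>) - sqrt b)\<^sup>2 \<le> 2 * (sqrt x - sqrt b)\<^sup>2 + 2 * \<eta>"
proof -
  have "\<bar>sqrt (x + \<eta>) - sqrt x\<bar> \<le> sqrt \<eta>"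
    using assms sqrt_add_le_add_sqrt[of x \<eta>] by (simp add: abs_if)
  then have "(sqrt (x + \<eta>) - sqrt x)\<^sup>2 \<le> \<eta>"
    using assms by (metis abs_ge_zero power2_abs power_mono real_sqrt_pow2)
  moreover have "(u + v)\<^sup>2 \<le> 2 * u\<^sup>2 + 2 * v\<^sup>2" for u v :: real
    using sum_squares_bound[of u v] by (simp add: power2_sum)
  from this[of "sqrt x - sqrt b" "sqrt (x + \<eta>) - sqrt x"]
  have "(sqrt (x + \<eta>) - sqrt b)\<^sup>2 \<le> 2 * (sqrt x - sqrt b)\<^sup>2 + 2 * (sqrt (x + \<eta>) - sqrt x)\<^sup>2"
    by simp
  ultimately show ?thesis by linarith
qed

lemma summable_sqrt_diff_sq:
  fixes f g :: "nat \<Rightarrow> real"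
  assumes "\<And>y. f y \<ge> 0" "\<And>y. g y \<ge> 0" "summable f" "summable g"
  shows "summable (\<lambda>y. (sqrt (f y) - sqrt (g y))\<^sup>2)" "summable (\<lambda>y. sqrt (f y) * sqrt (g y))"
proof -
  have "(sqrt u - sqrt v)\<^sup>2 \<le> u + v \<and> sqrt u * sqrt v \<le> u + v" if "u \<ge> 0" "v \<ge> 0" for u v :: real
  proof -
    have "2 * (sqrt u * sqrt v) \<le> u + v"
      using sum_squares_bound[of "sqrt u" "sqrt v"] that by (simp add: mult.assoc)
    moreover have "0 \<le> sqrt u * sqrt v" using that by simp
    ultimately show ?thesis using that by (auto simp: power2_diff mult.assoc simp del: zero_le_mult_iff)
  qed
  then have *: "(sqrt (f y) - sqrt (g y))\<^sup>2 \<le> f y + g y" "sqrt (f y) * sqrt (g y) \<le> f y + g y" for y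
    using assms by auto
  show "summable (\<lambda>y. (sqrt (f y) - sqrt (g y))\<^sup>2)"
    by (rule summable_comparison_test_ev[OF _ summable_add[OF assms(3,4)]])
       (use * in auto)
  show "summable (\<lambda>y. sqrt (f y) * sqrt (g y))"
    by (rule summable_comparison_test_ev[OF _ summable_add[OF assms(3,4)]])
       (use * assms in auto)
qed

lemma hellinger_sq_expand:
  assumes "\<And>y. f y \<ge> 0" "\<And>y. g y \<ge> 0" "summable f" "summable g"
  shows "hellinger_sq f g = suminf f + suminf g - 2 * (\<Sum>y. sqrt (f y) * sqrt (g y))"
proof -
  have "hellinger_sq f g = (\<Sum>y. f y + g y - 2 * (sqrt (f y) * sqrt (g y)))"
    unfolding hellinger_sq_def using assms by (intro suminf_cong) (simp add: power2_diff)
  also have "\<dots> = suminf f + suminf g - 2 * (\<Sum>y. sqrt (f y) * sqrt (g y))"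
    unfolding suminf_mult[OF summable_sqrt_diff_sq(2)[OF assms], symmetric]
      suminf_add[OF assms(3,4)]
    by (intro suminf_diff[symmetric] summable_add summable_mult assms summable_sqrt_diff_sq(2))
  finally show ?thesis .
qed

text \<open>With \<open>x^2\<close> the total mass of \<open>a\<close> and \<open>b\<close> the
  affinity of the normalised \<open>a\<close> with \<open>f\<close>, the two squared distances are
  \<open>2 - 2 * b\<close> and \<open>x^2 + 1 - 2 * x * b\<close>. The latter is smallest at
  \<open>x = b\<close>, with value \<open>1 - b^2 \<ge> 1 - b\<close>, as
  \<open>0 \<le> b \<le> 1\<close>. So an estimate can be built without regard to its total
  mass.\<close>

lemma hellinger_sq_normalise:
  fixes a f :: "nat \<Rightarrow> real"
  assumes a: "\<And>y. a y \<ge> 0" "summable a" "suminf a > 0"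
    and f: "\<And>y. f y \<ge> 0" "f sums 1"
  shows "hellinger_sq (\<lambda>y. a y / suminf a) f \<le> 2 * hellinger_sq a f"
proof -
  define A where "A = suminf a"
  define x where "x = sqrt A"
  define b where "b = (\<Sum>y. sqrt (a y / A) * sqrt (f y))"
  have A: "A > 0" using a by (simp add: A_def)
  have x: "x > 0" "x\<^sup>2 = A" using A by (auto simp: x_def)
  have nn: "\<And>y. a y / A \<ge> 0" using a A by auto
  have sm: "summable (\<lambda>y. a y / A)" using a by (intro summable_divide)
  have fs: "summable f" "suminf f = 1" using f by (auto simp: sums_iff)
  have "(\<Sum>y. a y / A) = 1" using a A by (subst suminf_divide) (auto simp: A_def)
  then have 1: "hellinger_sq (\<lambda>y. a y / A) f = 2 - 2 * b"
    using hellinger_sq_expand[OF nn f(1) sm fs(1)] fs by (simp add: b_def)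
  have "hellinger_sq (\<lambda>y. a y / A) f \<ge> 0"
    unfolding hellinger_sq_def using summable_sqrt_diff_sq(1)[OF nn f(1) sm fs(1)]
    by (intro suminf_nonneg) auto
  then have "b \<le> 1" using 1 by simp
  moreover have "b \<ge> 0" unfolding b_def
    using summable_sqrt_diff_sq(2)[OF nn f(1) sm fs(1)] nn f by (intro suminf_nonneg) auto
  ultimately have b: "b\<^sup>2 \<le> b" by (simp add: power2_eq_square mult_left_le)
  have "(\<Sum>y. sqrt (a y) * sqrt (f y)) = (\<Sum>y. x * (sqrt (a y / A) * sqrt (f y)))"
    using x A by (intro suminf_cong) (simp add: real_sqrt_divide x_def)
  also have "\<dots> = x * b" unfolding b_def
    using summable_sqrt_diff_sq(2)[OF nn f(1) sm fs(1)] by (rule suminf_mult)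
  finally have 2: "hellinger_sq a f = x\<^sup>2 + 1 - 2 * (x * b)"
    using hellinger_sq_expand[OF a(1) f(1) a(2) fs(1)] fs x by (simp add: A_def)
  have "0 \<le> (x - b)\<^sup>2 + (b - b\<^sup>2)" using b by simp
  then have "2 - 2 * b \<le> 2 * (x\<^sup>2 + 1 - 2 * (x * b))" by (simp add: power2_diff)
  then show ?thesis using 1 2 by (simp add: A_def)
qed

section \<open>Poisson likelihoods on square-root blocks\<close>

lemma poisson_lik_nonneg: "\<theta> \<ge> 0 \<Longrightarrow> poisson_lik \<theta> y \<ge> 0"
  by (simp add: poisson_lik_def)

lemma poisson_lik_sums: "poisson_lik \<theta> sums 1"
proof -
  have "(\<lambda>y. exp (-\<theta>) * (\<theta> ^ y /\<^sub>R fact y)) sums (exp (-\<theta>) * exp \<theta>)"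
    by (intro sums_mult exp_converges)
  then show ?thesis
    by (simp add: poisson_lik_def[abs_def] exp_minus divide_inverse mult_ac)
qed

lemma power_le_fact_exp: "x \<ge> 0 \<Longrightarrow> x ^ y \<le> fact y * exp (x :: real)"
proof -
  assume x: "x \<ge> 0"
  have "poisson_lik x y \<le> 1"
    using sum_le_suminf[OF sums_summable[OF poisson_lik_sums], of "{y}" x]
      sums_unique[OF poisson_lik_sums[of x]] poisson_lik_nonneg[OF x] by simp
  then show ?thesis by (simp add: poisson_lik_def exp_minus field_simps)
qed

text \<open>This is the concentration on the square-root scale. With
  \<open>\<theta> = y * x^2\<close> it combines \<open>x \<le> exp (x - 1)\<close>, raised to the
  power \<open>2 * y\<close>, with \<open>y^y \<le> y! * e^y\<close>; the exponents add up to
  \<open>- y * (x - 1)^2\<close>.\<close>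

lemma poisson_lik_le_exp:
  assumes "\<theta> \<ge> 0"
  shows "poisson_lik \<theta> y \<le> exp (- (sqrt \<theta> - sqrt (real y))\<^sup>2)"
proof (cases "y = 0 \<or> \<theta> = 0")
  case True
  then show ?thesis using assms by (cases y) (auto simp: poisson_lik_def)
next
  case False
  define x where "x = sqrt (\<theta> / real y)"
  have x: "x > 0" "x\<^sup>2 = \<theta> / real y" using False assms by (auto simp: x_def)
  have \<theta>: "\<theta> = real y * x\<^sup>2" using False x by simp
  have "x \<le> exp (x - 1)" using exp_ge_add_one_self[of "x - 1"] by simp
  then have "x ^ (2 * y) \<le> exp (x - 1) ^ (2 * y)" using x by (intro power_mono) auto
  also have "\<dots> = exp (real (2 * y) * (x - 1))" by (simp only: exp_of_nat_mult)
  finally have 1: "(x\<^sup>2) ^ y \<le> exp (real (2 * y) * (x - 1))" by (simp add: power_mult)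
  have "poisson_lik \<theta> y = exp (-\<theta>) * (x\<^sup>2) ^ y * (real y ^ y / fact y)"
    by (simp add: poisson_lik_def \<theta> power_mult_distrib)
  also have "\<dots> \<le> exp (-\<theta>) * exp (real (2 * y) * (x - 1)) * exp (real y)"
    using 1 power_le_fact_exp[of "real y" y]
    by (intro mult_mono) (auto simp: divide_le_eq mult_ac)
  also have "\<dots> = exp (- (sqrt \<theta> - sqrt (real y))\<^sup>2)"
  proof -
    have "sqrt \<theta> = sqrt (real y) * x" unfolding \<theta> using x(1) by (simp add: real_sqrt_mult)
    then have "(sqrt \<theta> - sqrt (real y))\<^sup>2 = real y * x\<^sup>2 - 2 * real y * x + real y"
      by (simp add: power2_diff power_mult_distrib)
    then show ?thesis unfolding \<theta> by (simp add: algebra_simps flip: exp_add)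
  qed
  finally show ?thesis .
qed

lemma poisson_lik_le_1: "\<theta> \<ge> 0 \<Longrightarrow> poisson_lik \<theta> y \<le> 1"
  using poisson_lik_le_exp[of \<theta> y] by (rule order_trans) auto

text \<open>Stated pointwise in \<open>\<theta>\<close>, so that integration against a prior uses
  only its \<open>p\<close>-th moment. For \<open>\<theta> > N / 4\<close> the bound
  \<open>1 \<le> (4 * \<theta> / N)^p\<close> is enough; for smaller \<open>\<theta>\<close> the
  tail is exponentially small in \<open>N\<close>, and the second constant converts this into a
  power.\<close>

lemma poisson_lik_tail_le:
  assumes "\<theta> \<ge> 0" "p > 0" "N > 0"
  shows "1 - (\<Sum>y<N. poisson_lik \<theta> y) \<le> (4 powr p * \<theta> powr p + (4 * p) powr p) * real N powr (-p)"
proof (cases "\<theta> \<le> real N / 4")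
  case False
  have "1 - (\<Sum>y<N. poisson_lik \<theta> y) \<le> 1"
    using assms by (simp add: sum_nonneg poisson_lik_nonneg)
  also have "1 \<le> (4 * \<theta> / real N) powr p"
    using False assms by (intro ge_one_powr_ge_zero) auto
  also have "\<dots> = 4 powr p * \<theta> powr p * real N powr (-p)"
    using assms by (simp add: powr_divide powr_mult powr_minus_divide)
  also have "\<dots> \<le> (4 powr p * \<theta> powr p + (4 * p) powr p) * real N powr (-p)"
    by (intro mult_right_mono) auto
  finally show ?thesis .
next
  case True
  have s: "summable (poisson_lik \<theta>)" "suminf (poisson_lik \<theta>) = 1"
    using poisson_lik_sums sums_iff by auto
  have s2: "(\<lambda>y. exp \<theta> * poisson_lik (2 * \<theta>) y) sums (exp \<theta> * 1)"
    by (intro sums_mult poisson_lik_sums)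
  have "1 - (\<Sum>y<N. poisson_lik \<theta> y) = (\<Sum>y. poisson_lik \<theta> (y + N))"
    using suminf_minus_initial_segment[OF s(1), of N] s by simp
  also have "\<dots> \<le> (\<Sum>y. (1/2) ^ N * (exp \<theta> * poisson_lik (2 * \<theta>) (y + N)))"
  proof (rule suminf_le)
    show "summable (\<lambda>y. poisson_lik \<theta> (y + N))" using s(1) by (rule summable_ignore_initial_segment)
    show "summable (\<lambda>y. (1/2) ^ N * (exp \<theta> * poisson_lik (2 * \<theta>) (y + N)))"
      using s2 by (intro summable_mult) (auto simp: sums_iff intro!: summable_mult summable_ignore_initial_segment)
    fix y
    \<comment> \<open>Doubling the rate costs \<open>exp \<theta>\<close> and gains
      \<open>2^-N\<close> beyond \<open>N\<close>; since \<open>\<theta> \<le> N / 4\<close>, the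
      gain prevails.\<close>
    have "poisson_lik \<theta> (y + N) = (1/2) ^ (y + N) * (exp \<theta> * poisson_lik (2 * \<theta>) (y + N))"
      by (simp add: poisson_lik_def power_mult_distrib power_divide flip: exp_add)
    also have "\<dots> \<le> (1/2) ^ N * (exp \<theta> * poisson_lik (2 * \<theta>) (y + N))"
      using assms by (intro mult_right_mono power_decreasing) (auto simp: poisson_lik_nonneg)
    finally show "poisson_lik \<theta> (y + N) \<le> (1/2) ^ N * (exp \<theta> * poisson_lik (2 * \<theta>) (y + N))" .
  qed
  also have "\<dots> = (1/2) ^ N * (\<Sum>y. exp \<theta> * poisson_lik (2 * \<theta>) (y + N))"
    using s2 by (intro suminf_mult) (auto simp: sums_iff intro!: summable_ignore_initial_segment)
  also have "(\<Sum>y. exp \<theta> * poisson_lik (2 * \<theta>) (y + N)) \<le> exp \<theta>"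
  proof -
    have "(\<Sum>y. exp \<theta> * poisson_lik (2 * \<theta>) (y + N)) =
        exp \<theta> - (\<Sum>y<N. exp \<theta> * poisson_lik (2 * \<theta>) y)"
      using s2 by (subst suminf_minus_initial_segment) (auto simp: sums_iff)
    then show ?thesis using assms by (simp add: sum_nonneg poisson_lik_nonneg)
  qed
  also have "exp \<theta> \<le> exp (real N / 4)" using True by simp
  also have "(1/2) ^ N * exp (real N / 4) \<le> exp (- (real N / 4))"
  proof -
    have "exp (1/2::real) \<le> 2" using exp_bound_half[of "1/2::real"] by simp
    then have "exp (1/2::real) ^ N \<le> 2 ^ N" by (intro power_mono) auto
    moreover have "exp (1/2::real) ^ N = exp (real N / 4) * exp (real N / 4)"
      by (simp flip: exp_of_nat_mult exp_add)
    ultimately show ?thesis by (simp add: exp_minus field_simps power_divide)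
  qed
  also have "exp (- (real N / 4)) \<le> (4 * p) powr p * real N powr (-p)"
  proof -
    have "real N / (4 * p) \<le> exp (real N / (4 * p))"
      using exp_ge_add_one_self[of "real N / (4 * p)"] by linarith
    then have "(real N / (4 * p)) powr p \<le> exp (real N / (4 * p)) powr p"
      using assms by (intro powr_mono2) auto
    also have "\<dots> = exp (real N / 4)" using assms by (simp add: exp_powr_real)
    finally have "real N powr p \<le> exp (real N / 4) * (4 * p) powr p"
      using assms by (simp add: powr_divide divide_le_eq)
    then show ?thesis using assms
      by (simp add: exp_minus powr_minus field_simps)
  qed
  also have "\<dots> \<le> (4 powr p * \<theta> powr p + (4 * p) powr p) * real N powr (-p)"
    by (intro mult_right_mono) auto
  finally show ?thesis by simp
qed

text \<open>The condition \<open>k \<le> D * sqrt y < k + 1\<close>, squared to stay within the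
  natural numbers; \<open>k\<close> is then \<open>floor_sqrt (D\<^sup>2 * y)\<close>, so the blocks
  partition the natural numbers.\<close>

definition block :: "nat \<Rightarrow> nat \<Rightarrow> nat set" where
  "block D k = {y. k\<^sup>2 \<le> D\<^sup>2 * y \<and> D\<^sup>2 * y < (k + 1)\<^sup>2}"

lemma finite_block: "D > 0 \<Longrightarrow> finite (block D k)"
proof (rule finite_subset)
  assume "D > 0"
  show "block D k \<subseteq> {..<(k + 1)\<^sup>2}"
  proof
    fix y assume "y \<in> block D k"
    moreover have "1 * y \<le> D\<^sup>2 * y" using \<open>D > 0\<close> by (intro mult_right_mono) auto
    ultimately show "y \<in> {..<(k + 1)\<^sup>2}" unfolding block_def lessThan_iff mem_Collect_eq by linarith
  qed
qed simp

text \<open>From \<open>(k + 1)^2 - k^2 = 2 * k + 1\<close> and \<open>k \<le> D * sqrt a\<close>.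
  The second bound says that a block with two points starts no lower than \<open>D^2 / 4\<close>;
  closer to 0 a block has at most one point.\<close>

lemma block_width:
  assumes a: "a \<in> block D k" and y: "a + t \<in> block D k" and t: "t > 0" and D: "D > 0"
  shows "real D * real t \<le> 2 * sqrt (real a)" "real D \<le> 2 * sqrt (real a)"
proof -
  have "D\<^sup>2 * (a + t) < (k + 1)\<^sup>2" "k\<^sup>2 \<le> D\<^sup>2 * a" using a y by (auto simp: block_def)
  then have "D\<^sup>2 * t \<le> 2 * k" by (simp add: power2_eq_square algebra_simps)
  then have 1: "(real D)\<^sup>2 * real t \<le> 2 * real k" by (metis of_nat_le_iff of_nat_mult of_nat_numeral of_nat_power)
  have "(real k)\<^sup>2 \<le> (real D * sqrt (real a))\<^sup>2"
    using \<open>k\<^sup>2 \<le> D\<^sup>2 * a\<close> by (simp add: power_mult_distrib) (metis of_nat_le_iff of_nat_mult of_nat_power)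
  then have "real k \<le> real D * sqrt (real a)" by (rule power2_le_imp_le) auto
  then have "real D * (real D * real t) \<le> real D * (2 * sqrt (real a))"
    using 1 by (simp add: power2_eq_square)
  then show *: "real D * real t \<le> 2 * sqrt (real a)" using D by simp
  have "real D * 1 \<le> real D * real t" using t by (intro mult_left_mono) auto
  then show "real D \<le> 2 * sqrt (real a)" using * by simp
qed

text \<open>Here \<open>D\<close> is matched to the window \<open>L\<close>:
  \<open>|\<theta> - a| \<le> 3 * L * sqrt a\<close> within the window and
  \<open>t \<le> sqrt a / (12 * L)\<close> within the block, so \<open>L\<close> cancels in the
  product. The relative displacement \<open>u = (\<theta> - a) / a\<close> then satisfies
  \<open>t * |u| \<le> 1 / 2\<close>, on which both block estimates below rest.\<close>

lemma block_offset_bounds: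
  assumes a: "a \<in> block D k" and y: "a + t \<in> block D k" and t: "t > 0"
    and D: "real D = 24 * L" and L: "L \<ge> 1"
    and \<theta>: "\<theta> \<ge> 0" "\<bar>sqrt \<theta> - sqrt (real a)\<bar> \<le> L"
  shows "a > 0" "real t * \<bar>\<theta> - real a\<bar> \<le> real a / 2" "(real t)\<^sup>2 \<le> real a / 4"
proof -
  define r where "r = sqrt (real a)"
  have D0: "D > 0" using D L by (cases D) auto
  have w: "24 * L * real t \<le> 2 * r" "24 * L \<le> 2 * r"
    using block_width[OF a y t D0] D by (auto simp: r_def)
  have r: "r > 0" using w L by linarith
  have ra: "r\<^sup>2 = real a" by (simp add: r_def)
  show "a > 0" using r by (simp add: r_def)
  have "sqrt \<theta> + r \<le> 2 * r + L" using \<theta>(2) by (simp add: r_def)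
  have "\<bar>\<theta> - real a\<bar> = \<bar>sqrt \<theta> - r\<bar> * (sqrt \<theta> + r)"
  proof -
    have "\<theta> - real a = (sqrt \<theta> - r) * (sqrt \<theta> + r)"
      using \<theta> ra by (simp add: algebra_simps power2_eq_square)
    then show ?thesis using \<theta> r by (simp add: abs_mult)
  qed
  also have "\<dots> \<le> L * (2 * r + L)"
    using \<open>sqrt \<theta> + r \<le> 2 * r + L\<close> \<theta> r L by (intro mult_mono) (auto simp: r_def)
  also have "\<dots> \<le> L * (3 * r)" using w L by (intro mult_left_mono) auto
  finally have "real t * \<bar>\<theta> - real a\<bar> \<le> real t * (L * (3 * r))" by (intro mult_left_mono) auto
  also have "\<dots> = (L * real t) * (3 * r)" by simp
  also have "\<dots> \<le> (r / 12) * (3 * r)" using w r by (intro mult_right_mono) auto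
  also have "\<dots> \<le> real a / 2" using ra by (simp add: power2_eq_square)
  finally show "real t * \<bar>\<theta> - real a\<bar> \<le> real a / 2" .
  have "1 * real t \<le> L * real t" using L by (intro mult_right_mono) auto
  then have "real t \<le> r / 2" using w r by linarith
  then have "(real t)\<^sup>2 \<le> (r / 2)\<^sup>2" by (intro power_mono) auto
  then show "(real t)\<^sup>2 \<le> real a / 4" using ra by (simp add: power_divide)
qed

lemma fact_add_bounds:
  "fact a * real a ^ t \<le> fact (a + t)" "fact (a + t) \<le> fact a * real (a + t) ^ t"
proof -
  have "fact a * real a ^ t \<le> fact (a + t) \<and> fact (a + t) \<le> fact a * real (a + t) ^ t"
  proof (induction t)
    case (Suc t)
    have "fact a * real a ^ Suc t = (fact a * real a ^ t) * real a" by simp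
    also have "\<dots> \<le> fact (a + t) * real (a + t + 1)" using Suc by (intro mult_mono) auto
    also have "\<dots> = fact (a + Suc t)" by (simp add: algebra_simps)
    finally have 1: "fact a * real a ^ Suc t \<le> fact (a + Suc t)" .
    have "fact (a + Suc t) = fact (a + t) * real (a + Suc t)" by (simp add: algebra_simps)
    also have "\<dots> \<le> (fact a * real (a + t) ^ t) * real (a + Suc t)"
      using Suc by (intro mult_right_mono) auto
    also have "\<dots> \<le> (fact a * real (a + Suc t) ^ t) * real (a + Suc t)"
      by (intro mult_right_mono mult_left_mono power_mono) auto
    finally show ?case using 1 by (simp add: mult_ac)
  qed simp
  then show "fact a * real a ^ t \<le> fact (a + t)" "fact (a + t) \<le> fact a * real (a + t) ^ t" by auto
qed

text \<open>The ratio of the two likelihoods is \<open>\<theta>^t * a! / (a + t)!\<close>. Comparing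
  the factorials with powers of \<open>a\<close> or of \<open>a + t\<close> turns it into
  \<open>(1 + u)^t \<le> exp (t * u)\<close> from above, with \<open>exp (1/2) \<le> 2\<close>, and
  into a Bernoulli bound from below.\<close>

lemma poisson_lik_block_comparable:
  assumes a: "a \<in> block D k" and y: "a + t \<in> block D k"
    and D: "real D = 24 * L" and L: "L \<ge> 1"
    and \<theta>: "\<theta> \<ge> 0" "\<bar>sqrt \<theta> - sqrt (real a)\<bar> \<le> L"
  shows "poisson_lik \<theta> (a + t) \<le> 2 * poisson_lik \<theta> a"
    and "poisson_lik \<theta> a \<le> 4 * poisson_lik \<theta> (a + t)"
proof -
  have "poisson_lik \<theta> (a + t) \<le> 2 * poisson_lik \<theta> a \<and> poisson_lik \<theta> a \<le> 4 * poisson_lik \<theta> (a + t)"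
  proof (cases "t = 0")
    case True
    then show ?thesis using poisson_lik_nonneg[OF \<theta>(1), of a] by simp
  next
    case False
    note b = block_offset_bounds[OF a y _ D L \<theta>]
    have a0: "a > 0" and tu: "real t * \<bar>\<theta> - real a\<bar> \<le> real a / 2" and t2: "(real t)\<^sup>2 \<le> real a / 4"
      using b False by auto
    define u where "u = (\<theta> - real a) / real a"
    have \<theta>u: "\<theta> = real a * (1 + u)" using a0 by (simp add: u_def field_simps)
    have e: "poisson_lik \<theta> (a + t) = poisson_lik \<theta> a * (\<theta> ^ t * fact a / fact (a + t))"
      by (simp add: poisson_lik_def power_add)
    have "\<theta> ^ t * fact a / fact (a + t) = (1 + u) ^ t * (fact a * real a ^ t / fact (a + t))"
      by (simp add: \<theta>u power_mult_distrib)
    also have "\<dots> \<le> exp u ^ t * 1"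
    proof (intro mult_mono power_mono)
      show "0 \<le> 1 + u" using \<theta> \<theta>u a0 by (simp add: zero_le_mult_iff)
    qed (use fact_add_bounds(1)[of a t] exp_ge_add_one_self[of u] in \<open>auto simp: divide_le_eq add.commute\<close>)
    also have "\<dots> = exp (real t * u)" by (simp add: exp_of_nat_mult)
    also have "\<dots> \<le> exp (1/2)"
    proof -
      have "real t * (\<theta> - real a) \<le> real t * \<bar>\<theta> - real a\<bar>" by (intro mult_left_mono) auto
      then show ?thesis using tu a0 by (simp add: u_def divide_le_eq)
    qed
    also have "\<dots> \<le> 2" using exp_bound_half[of "1/2::real"] by simp
    finally have up: "\<theta> ^ t * fact a / fact (a + t) \<le> 2" .
    \<comment> \<open>The displacement is now relative to \<open>a + t\<close>, the base in the
      upper bound for \<open>(a + t)!\<close>. The extra \<open>- t\<close> in the numerator costs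
      \<open>t^2 \<le> a / 4\<close>, so \<open>t * v \<ge> - (1/2 + 1/4)\<close>.\<close>
    define v where "v = (\<theta> - real a - real t) / real (a + t)"
    have v: "1 + v = \<theta> / real (a + t)" using a0 by (simp add: v_def field_simps)
    have "- (3/4) \<le> real t * v"
    proof -
      have "real t * (real a + real t - \<theta>) \<le> real t * \<bar>\<theta> - real a\<bar> + (real t)\<^sup>2"
      proof -
        have "real t * (real a - \<theta>) \<le> real t * \<bar>\<theta> - real a\<bar>" by (intro mult_left_mono) auto
        then show ?thesis by (simp add: power2_eq_square algebra_simps)
      qed
      also have "\<dots> \<le> 3/4 * real a" using tu t2 by simp
      also have "\<dots> \<le> 3/4 * real (a + t)" by simp
      finally have "real t * (real a + real t - \<theta>) / real (a + t) \<le> 3/4"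
        using a0 by (simp add: divide_le_eq)
      moreover have "real t * (real a + real t - \<theta>) / real (a + t) = - (real t * v)"
        by (simp add: v_def minus_divide_left right_diff_distrib distrib_left)
      ultimately show ?thesis by linarith
    qed
    then have "1/4 \<le> 1 + real t * v" by simp
    also have "\<dots> \<le> (1 + v) ^ t"
      using v \<theta> by (intro Bernoulli_inequality) (smt (verit) divide_nonneg_nonneg of_nat_0_le_iff)
    also have "\<dots> = \<theta> ^ t * (1 / real (a + t) ^ t)" by (simp add: v power_divide)
    also have "\<dots> \<le> \<theta> ^ t * (fact a / fact (a + t))"
      using \<theta> a0 fact_add_bounds(2)[of a t]
      by (intro mult_left_mono) (auto simp: field_simps)
    finally have lo: "1/4 \<le> \<theta> ^ t * fact a / fact (a + t)" by simp
    have "poisson_lik \<theta> a * (1/4) \<le> poisson_lik \<theta> (a + t)"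
      unfolding e using lo poisson_lik_nonneg[OF \<theta>(1), of a] by (rule mult_left_mono)
    moreover have "poisson_lik \<theta> (a + t) \<le> poisson_lik \<theta> a * 2"
      unfolding e using up poisson_lik_nonneg[OF \<theta>(1), of a] by (rule mult_left_mono)
    ultimately show ?thesis by simp
  qed
  then show "poisson_lik \<theta> (a + t) \<le> 2 * poisson_lik \<theta> a"
    "poisson_lik \<theta> a \<le> 4 * poisson_lik \<theta> (a + t)" by auto
qed

text \<open>With \<open>\<theta> = a * (1 + u)\<close> the likelihood at \<open>a + t\<close> is a
  factor of at most 1 times \<open>(1 + u)^t\<close>, whose binomial expansion is cut after
  \<open>m\<close> terms. The \<open>j\<close>-th term is at most
  \<open>(t * |u|)^j \<le> 2^-j\<close>, so the error is a geometric tail.\<close>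

lemma poisson_lik_block_approx:
  assumes a: "a \<in> block D k" and y: "a + t \<in> block D k"
    and D: "real D = 24 * L" and L: "L \<ge> 1" and m: "m > 0"
    and \<theta>: "\<theta> \<ge> 0" "\<bar>sqrt \<theta> - sqrt (real a)\<bar> \<le> L"
  shows "\<bar>poisson_lik \<theta> (a + t) - exp (-\<theta>) * \<theta> ^ a * (real a ^ t / fact (a + t)) *
    (\<Sum>j<m. real (t choose j) * ((\<theta> - real a) / real a) ^ j)\<bar> \<le> 2 * (1/2) ^ m"
proof (cases "t = 0")
  \<comment> \<open>Offset 0 is separate because \<open>a\<close> may be 0, where division by
    \<open>real a\<close> gives 0. Only the term \<open>j = 0\<close> survives, and
    \<open>m > 0\<close> keeps it in the sum.\<close>
  case True
  obtain m' where "m = Suc m'" using m by (cases m) auto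
  then have "(\<Sum>j<m. real (t choose j) * ((\<theta> - real a) / real a) ^ j) = 1"
    unfolding \<open>m = Suc m'\<close> by (subst sum.lessThan_Suc_shift) (simp add: True)
  then show ?thesis using True by (simp add: poisson_lik_def)
next
  case False
  define u where "u = (\<theta> - real a) / real a"
  note b = block_offset_bounds[OF a y _ D L \<theta>]
  have a0: "a > 0" and tu: "real t * \<bar>\<theta> - real a\<bar> \<le> real a / 2" using b False by auto
  have tu': "real t * \<bar>u\<bar> \<le> 1/2" using tu a0 by (simp add: u_def divide_le_eq)
  have \<theta>u: "\<theta> = real a * (1 + u)" using a0 by (simp add: u_def field_simps)
  define F where "F j = real (t choose j) * u ^ j" for j
  define R where "R = (\<Sum>j\<in>{m..<m+t+1}. F j)"
  have "(1 + u) ^ t = (\<Sum>j\<le>t. F j)"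
    using binomial_ring[of u 1 t] by (simp add: F_def add.commute)
  \<comment> \<open>Extending the sum by vanishing binomial coefficients avoids comparing
    \<open>m\<close> with \<open>t\<close>.\<close>
  also have "\<dots> = (\<Sum>j<m+t+1. F j)"
    by (intro sum.mono_neutral_left) (auto simp: F_def)
  also have "\<dots> = (\<Sum>j<m. F j) + R"
    unfolding R_def by (subst sum.atLeastLessThan_concat[of 0 m "m+t+1", unfolded atLeast0LessThan, symmetric]) auto
  finally have split: "(1 + u) ^ t = (\<Sum>j<m. F j) + R" .
  have F: "\<bar>F j\<bar> \<le> (1/2) ^ j" for j
  proof -
    have "real (t choose j) \<le> real (t ^ j)"
      by (cases "j \<le> t") (auto simp: binomial_eq_0 of_nat_power[symmetric] simp del: of_nat_power intro: binomial_le_pow)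
    then have "real (t choose j) * \<bar>u\<bar> ^ j \<le> real t ^ j * \<bar>u\<bar> ^ j"
      by (intro mult_right_mono) auto
    then have "\<bar>F j\<bar> \<le> (real t * \<bar>u\<bar>) ^ j"
      by (simp add: F_def abs_mult power_abs power_mult_distrib)
    also have "\<dots> \<le> (1/2) ^ j" using tu' by (intro power_mono) auto
    finally show ?thesis .
  qed
  have "\<bar>R\<bar> \<le> (\<Sum>j\<in>{m..<m+t+1}. (1/2) ^ j)"
    unfolding R_def by (rule order_trans[OF sum_abs]) (intro sum_mono F)
  also have "\<dots> = (1/2) ^ m * (\<Sum>j<t+1. (1/2) ^ j)"
    unfolding sum_distrib_left
    by (rule sum.reindex_bij_witness[of _ "\<lambda>j. j + m" "\<lambda>j. j - m"]) (auto simp: power_add[symmetric])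
  also have "\<dots> \<le> (1/2) ^ m * 2"
    by (intro mult_left_mono) (auto simp: geometric_sum)
  finally have R: "\<bar>R\<bar> \<le> 2 * (1/2) ^ m" by simp
  define c where "c = exp (-\<theta>) * \<theta> ^ a * (real a ^ t / fact (a + t))"
  have "c = poisson_lik \<theta> a * (fact a * real a ^ t / fact (a + t))"
    by (simp add: c_def poisson_lik_def)
  moreover have "poisson_lik \<theta> a * (fact a * real a ^ t / fact (a + t)) \<le> 1 * 1"
    using fact_add_bounds(1)[of a t] poisson_lik_le_1[OF \<theta>(1), of a]
    by (intro mult_mono) (simp_all add: divide_le_eq)
  ultimately have "c \<le> 1" by simp
  moreover have "0 \<le> c" using \<theta> by (simp add: c_def)
  ultimately have c: "0 \<le> c" "c \<le> 1" by auto
  have "poisson_lik \<theta> (a + t) = c * (1 + u) ^ t"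
  proof -
    have "\<theta> ^ (a + t) = \<theta> ^ a * (real a ^ t * (1 + u) ^ t)"
      unfolding power_add by (subst (2) \<theta>u) (simp add: power_mult_distrib)
    then show ?thesis by (simp add: c_def poisson_lik_def)
  qed
  then have "poisson_lik \<theta> (a + t) - c * (\<Sum>j<m. F j) = c * R"
    by (simp add: split algebra_simps)
  moreover have "\<bar>c * R\<bar> \<le> 1 * (2 * (1/2) ^ m)"
    unfolding abs_mult using c R by (intro mult_mono) auto
  ultimately show ?thesis by (simp add: c_def F_def u_def)
qed

section \<open>Poisson mixtures\<close>

lemma block_sqrt_diff:
  assumes "y \<in> block D k" "z \<in> block D k" "D > 0"
  shows "\<bar>sqrt (real y) - sqrt (real z)\<bar> \<le> 1"
proof -
  have *: "real k \<le> real D * sqrt (real x)" "real D * sqrt (real x) \<le> real k + 1" if "x \<in> block D k" for x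
  proof -
    have "real (k\<^sup>2) \<le> real (D\<^sup>2 * x)" "real (D\<^sup>2 * x) \<le> real ((k + 1)\<^sup>2)"
      using that unfolding block_def of_nat_le_iff by auto
    then have "(real k)\<^sup>2 \<le> (real D * sqrt (real x))\<^sup>2" "(real D * sqrt (real x))\<^sup>2 \<le> (real k + 1)\<^sup>2"
      by (simp_all add: power_mult_distrib add.commute)
    then show "real k \<le> real D * sqrt (real x)" "real D * sqrt (real x) \<le> real k + 1"
      by (auto intro: power2_le_imp_le)
  qed
  have "1 * \<bar>sqrt (real y) - sqrt (real z)\<bar> \<le> real D * \<bar>sqrt (real y) - sqrt (real z)\<bar>"
    using assms by (intro mult_right_mono) auto
  also have "\<dots> = \<bar>real D * sqrt (real y) - real D * sqrt (real z)\<bar>"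
    by (simp add: abs_mult flip: right_diff_distrib)
  also have "\<dots> \<le> 1" using *[OF assms(1)] *[OF assms(2)] by (simp add: abs_if)
  finally show ?thesis by simp
qed

text \<open>A block has width at most 1 on the square-root scale, so a \<open>\<theta>\<close>
  outside the window of radius \<open>L\<close> about \<open>a\<close> keeps distance at least
  \<open>L - 1\<close> from every point of the block.\<close>

lemma poisson_lik_block_far:
  assumes "a \<in> block D k" "z \<in> block D k" "D > 0" "L \<ge> 1" "\<theta> \<ge> 0" "\<not> \<bar>sqrt \<theta> - sqrt (real a)\<bar> \<le> L"
  shows "poisson_lik \<theta> z \<le> exp (- (L - 1)\<^sup>2)"
proof -
  have "L - 1 \<le> \<bar>sqrt \<theta> - sqrt (real z)\<bar>"
    using block_sqrt_diff[OF assms(1-3)] assms(6) by linarith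
  then have "(L - 1)\<^sup>2 \<le> (sqrt \<theta> - sqrt (real z))\<^sup>2"
    using assms(4) by (intro abs_le_square_iff[THEN iffD1]) auto
  then show ?thesis using poisson_lik_le_exp[OF assms(5), of z] by (smt (verit) exp_le_cancel_iff)
qed

text \<open>With \<open>\<theta> = a (1 + u)\<close>, the likelihood at \<open>y = a + t\<close> is
  \<open>e\<^bsup>-\<theta>\<^esup> \<theta>\<^bsup>a\<^esup> (1 + u)\<^bsup>t\<^esup> a\<^bsup>t\<^esup> / y!\<close>, and the basis functions are the coefficients of
  \<open>u\<^bsup>j\<^esup>\<close> in \<open>(1 + u)\<^bsup>t\<^esup> a\<^bsup>t\<^esup> / y!\<close>.\<close>

definition block_basis :: "nat \<Rightarrow> nat \<Rightarrow> nat \<Rightarrow> nat \<Rightarrow> real" where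
  "block_basis D k j y = (let a = (LEAST x. x \<in> block D k)
    in real a ^ (y - a) / fact y * real ((y - a) choose j))"

locale nonneg_prior = prob_space G for G :: "real measure" +
  assumes sets_G [measurable_cong]: "sets G = sets borel" and nonneg: "AE \<theta> in G. 0 \<le> \<theta>"
begin

lemma integrable_poisson_lik: "integrable G (\<lambda>\<theta>. poisson_lik \<theta> y)"
proof (rule integrable_const_bound[of _ 1])
  show "AE \<theta> in G. norm (poisson_lik \<theta> y) \<le> 1"
    using nonneg by eventually_elim (simp add: poisson_lik_nonneg poisson_lik_le_1)
  show "(\<lambda>\<theta>. poisson_lik \<theta> y) \<in> borel_measurable G"
    unfolding poisson_lik_def by measurable
qed

lemma poisson_mixture_nonneg: "poisson_mixture G y \<ge> 0"
  unfolding poisson_mixture_def using nonneg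
  by (intro integral_nonneg_AE) (auto elim!: eventually_mono simp: poisson_lik_nonneg)

lemma nn_integral_poisson_lik:
  "(\<integral>\<^sup>+\<theta>. ennreal (poisson_lik \<theta> y) \<partial>G) = ennreal (poisson_mixture G y)"
  unfolding poisson_mixture_def using nonneg
  by (intro nn_integral_eq_integral integrable_poisson_lik)
     (auto elim!: eventually_mono simp: poisson_lik_nonneg)

lemma nn_integral_suminf_poisson_lik: "(\<integral>\<^sup>+\<theta>. (\<Sum>y. ennreal (poisson_lik \<theta> y)) \<partial>G) = 1"
proof -
  have "AE \<theta> in G. (\<Sum>y. ennreal (poisson_lik \<theta> y)) = 1"
    using nonneg
  proof eventually_elim
    case (elim \<theta>)
    then show ?case
      using suminf_ennreal_eq[OF poisson_lik_nonneg poisson_lik_sums] by simp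
  qed
  then show ?thesis by (subst nn_integral_cong_AE) (auto simp: emeasure_space_1)
qed

lemma poisson_mixture_sums: "poisson_mixture G sums 1"
proof -
  have "(\<Sum>y. ennreal (poisson_mixture G y)) = (\<integral>\<^sup>+\<theta>. (\<Sum>y. ennreal (poisson_lik \<theta> y)) \<partial>G)"
    unfolding nn_integral_poisson_lik[symmetric]
    by (rule nn_integral_suminf[symmetric]) (auto simp: poisson_lik_def)
  then have 1: "(\<Sum>y. ennreal (poisson_mixture G y)) = 1"
    using nn_integral_suminf_poisson_lik by simp
  then have s: "summable (poisson_mixture G)"
    by (intro summable_suminf_not_top poisson_mixture_nonneg) simp
  then have "ennreal (suminf (poisson_mixture G)) = ennreal 1"
    using 1 suminf_ennreal_eq[OF poisson_mixture_nonneg summable_sums[OF s]] by simp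
  then have "suminf (poisson_mixture G) = 1"
    by (subst (asm) ennreal_inj) (auto intro: suminf_nonneg s poisson_mixture_nonneg)
  then show ?thesis using s by (simp add: sums_iff)
qed

lemma poisson_mixture_tail_le:
  assumes "p > 0" "N > 0" and mom: "(\<integral>\<^sup>+u. ennreal (u powr p) \<partial>G) \<le> 1"
  shows "1 - (\<Sum>y<N. poisson_mixture G y) \<le> (4 powr p + (4 * p) powr p) * real N powr (-p)"
proof -
  have "(\<lambda>u. u powr p) \<in> borel_measurable G" by measurable
  moreover have "(\<integral>\<^sup>+u. ennreal (norm (u powr p)) \<partial>G) < \<infinity>"
    using mom by (simp add: order.strict_trans1)
  ultimately have i: "integrable G (\<lambda>u. u powr p)" by (simp add: integrable_iff_bounded)
  have "ennreal (\<integral>u. u powr p \<partial>G) \<le> ennreal 1"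
    using mom by (subst nn_integral_eq_integral[OF i, symmetric]) auto
  then have m1: "(\<integral>u. u powr p \<partial>G) \<le> 1"
    by (subst (asm) ennreal_le_iff) auto
  have "1 - (\<Sum>y<N. poisson_mixture G y) = (\<integral>\<theta>. 1 - (\<Sum>y<N. poisson_lik \<theta> y) \<partial>G)"
    unfolding poisson_mixture_def
    using integrable_poisson_lik by (simp add: prob_space)
  also have "\<dots> \<le> (\<integral>\<theta>. (4 powr p * \<theta> powr p + (4 * p) powr p) * real N powr (-p) \<partial>G)"
    using nonneg assms(1,2) i integrable_poisson_lik
    by (intro integral_mono_AE) (auto elim!: eventually_mono intro!: poisson_lik_tail_le)
  also have "\<dots> = (4 powr p * (\<integral>u. u powr p \<partial>G) + (4 * p) powr p) * real N powr (-p)"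
    using i by (simp add: prob_space)
  also have "\<dots> \<le> (4 powr p + (4 * p) powr p) * real N powr (-p)"
    using m1 by (intro mult_right_mono add_right_mono) (auto simp: mult_left_le)
  finally show ?thesis .
qed

text \<open>Both likelihoods are compared with the one at the least point of the block, whence
  \<open>8 = 2 * 4\<close>. The additive term pays for \<open>\<theta>\<close> outside the window,
  where the ratio of the likelihoods is not bounded.\<close>

lemma poisson_mixture_block_comparable:
  assumes y: "y \<in> block D k" and z: "z \<in> block D k" and D: "real D = 24 * L" and L: "L \<ge> 1"
  shows "poisson_mixture G z \<le> 8 * poisson_mixture G y + exp (- (L - 1)\<^sup>2)"
proof -
  have D0: "D > 0" using D L by (cases D) auto
  define a where "a = (LEAST x. x \<in> block D k)"
  have a: "a \<in> block D k" unfolding a_def using y by (rule LeastI)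
  have ay: "y = a + (y - a)" and az: "z = a + (z - a)"
    using Least_le[of "\<lambda>x. x \<in> block D k"] y z by (auto simp: a_def)
  have pt: "poisson_lik \<theta> z \<le> 8 * poisson_lik \<theta> y + exp (- (L - 1)\<^sup>2)" if \<theta>: "\<theta> \<ge> 0" for \<theta>
  proof (cases "\<bar>sqrt \<theta> - sqrt (real a)\<bar> \<le> L")
    case True
    have "poisson_lik \<theta> z \<le> 2 * poisson_lik \<theta> a" "poisson_lik \<theta> a \<le> 4 * poisson_lik \<theta> y"
      using poisson_lik_block_comparable[OF a _ D L \<theta> True] y z ay az by metis+
    moreover have "0 \<le> exp (- (L - 1)\<^sup>2)" by simp
    ultimately show ?thesis by linarith
  next
    case False
    then show ?thesis
      using poisson_lik_block_far[OF a z D0 L \<theta>] poisson_lik_nonneg[OF \<theta>, of y] by linarith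
  qed
  have "poisson_mixture G z \<le> (\<integral>\<theta>. 8 * poisson_lik \<theta> y + exp (- (L - 1)\<^sup>2) \<partial>G)"
    unfolding poisson_mixture_def using nonneg integrable_poisson_lik
    by (intro integral_mono_AE) (auto elim!: eventually_mono intro: pt)
  also have "\<dots> = 8 * poisson_mixture G y + exp (- (L - 1)\<^sup>2)"
    using integrable_poisson_lik by (simp add: prob_space poisson_mixture_def)
  finally show ?thesis .
qed

text \<open>The coefficient \<open>c j\<close> is the integral of
  \<open>exp (-\<theta>) * \<theta>^a * u^j\<close> against the prior, restricted to the window. It
  depends on the unknown prior, but the projection needs only its existence. Outside the window the
  approximation is 0 and the likelihood itself is the error.\<close>

lemma poisson_mixture_block_approx:
  fixes D k m :: nat and L :: real
  assumes D: "real D = 24 * L" and L: "L \<ge> 1" and m: "m > 0"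
  shows "\<exists>c. \<forall>y\<in>block D k. \<bar>poisson_mixture G y - (\<Sum>j<m. c j * block_basis D k j y)\<bar>
      \<le> 2 * (1/2) ^ m + exp (- (L - 1)\<^sup>2)"
proof -
  define a where "a = (LEAST x. x \<in> block D k)"
  have D0: "D > 0" using D L by (cases D) auto
  define I where "I = {\<theta>. 0 \<le> \<theta> \<and> \<bar>sqrt \<theta> - sqrt (real a)\<bar> \<le> L}"
  define g where "g j \<theta> = indicator I \<theta> * (exp (-\<theta>) * \<theta> ^ a * ((\<theta> - real a) / real a) ^ j)" for j \<theta>
  define c where "c j = (\<integral>\<theta>. g j \<theta> \<partial>G)" for j
  have g: "integrable G (g j)" for j
  proof (rule integrable_const_bound)
    define K where "K = (sqrt (real a) + L)\<^sup>2"
    show "AE \<theta> in G. norm (g j \<theta>) \<le> 1 * K ^ a * (K + real a) ^ j"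
    proof (rule AE_I2)
      fix \<theta>
      show "norm (g j \<theta>) \<le> 1 * K ^ a * (K + real a) ^ j"
      proof (cases "\<theta> \<in> I")
        case True
        then have \<theta>: "0 \<le> \<theta>" "sqrt \<theta> \<le> sqrt (real a) + L" by (auto simp: I_def)
        then have "(sqrt \<theta>)\<^sup>2 \<le> K" unfolding K_def by (intro power_mono) auto
        then have K: "\<theta> \<le> K" using \<theta> by simp
        have "\<bar>(\<theta> - real a) / real a\<bar> \<le> \<bar>\<theta> - real a\<bar>"
          by (cases "a = 0") (auto simp: divide_le_eq abs_mult mult_left_le mult_le_cancel_left1)
        also have "\<dots> \<le> K + real a" using K \<theta> by (simp add: abs_if)
        finally have "exp (-\<theta>) * \<theta> ^ a * \<bar>(\<theta> - real a) / real a\<bar> ^ j \<le> 1 * K ^ a * (K + real a) ^ j"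
          using K \<theta> by (intro mult_mono power_mono) auto
        then show ?thesis using True \<theta> by (simp add: g_def abs_mult power_abs)
      next
        case False
        then show ?thesis by (simp add: g_def K_def)
      qed
    qed
    show "g j \<in> borel_measurable G" unfolding g_def[abs_def] I_def by measurable
  qed
  have "\<bar>poisson_mixture G y -
    (\<Sum>j<m. c j * (real a ^ (y - a) / fact y * real ((y - a) choose j)))\<bar>
      \<le> 2 * (1/2) ^ m + exp (- (L - 1)\<^sup>2)" (is "\<bar>_ - (\<Sum>j<m. c j * ?e j)\<bar> \<le> ?b")
    if y: "y \<in> block D k" for y
  proof -
    have a: "a \<in> block D k" unfolding a_def using y by (rule LeastI)
    have ay: "a + (y - a) = y"
      using Least_le[of "\<lambda>x. x \<in> block D k", OF y] by (auto simp: a_def)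
    define h where "h \<theta> = poisson_lik \<theta> y - (\<Sum>j<m. g j \<theta> * ?e j)" for \<theta>
    have pt: "\<bar>h \<theta>\<bar> \<le> ?b" if \<theta>: "\<theta> \<ge> 0" for \<theta>
    proof (cases "\<bar>sqrt \<theta> - sqrt (real a)\<bar> \<le> L")
      case True
      then have "h \<theta> = poisson_lik \<theta> (a + (y - a)) - exp (-\<theta>) * \<theta> ^ a *
          (real a ^ (y - a) / fact (a + (y - a))) *
          (\<Sum>j<m. real ((y - a) choose j) * ((\<theta> - real a) / real a) ^ j)"
        unfolding h_def ay using \<theta> by (simp add: g_def I_def sum_distrib_left mult_ac)
      then have "\<bar>h \<theta>\<bar> \<le> 2 * (1/2) ^ m"
        using poisson_lik_block_approx[OF a _ D L m \<theta> True, of "y - a"] y unfolding ay by simp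
      then show ?thesis by (simp add: add_increasing2)
    next
      case False
      then have "h \<theta> = poisson_lik \<theta> y" by (simp add: h_def g_def I_def)
      then have "\<bar>h \<theta>\<bar> \<le> exp (- (L - 1)\<^sup>2)"
        using poisson_lik_block_far[OF a y D0 L \<theta> False] poisson_lik_nonneg[OF \<theta>, of y] by simp
      then show ?thesis by (simp add: add_increasing)
    qed
    have ih: "integrable G h" unfolding h_def[abs_def]
      using g integrable_poisson_lik by auto
    have "poisson_mixture G y - (\<Sum>j<m. c j * ?e j) = (\<integral>\<theta>. h \<theta> \<partial>G)"
      unfolding h_def c_def poisson_mixture_def using g integrable_poisson_lik by simp
    also have "\<bar>\<dots>\<bar> \<le> (\<integral>\<theta>. \<bar>h \<theta>\<bar> \<partial>G)" by (rule integral_abs_bound)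
    also have "\<dots> \<le> (\<integral>\<theta>. ?b \<partial>G)"
      using nonneg ih by (intro integral_mono_AE) (auto elim!: eventually_mono intro: pt)
    also have "\<dots> = ?b" by (simp add: prob_space)
    finally show ?thesis .
  qed
  then show ?thesis unfolding block_basis_def Let_def a_def[symmetric] by blast
qed

end

lemma prior_classD:
  assumes "G \<in> prior_class p"
  shows "nonneg_prior G" "(\<integral>\<^sup>+u. ennreal (u powr p) \<partial>G) \<le> 1"
proof -
  interpret prob_space G using assms by (simp add: prior_class_def)
  have s: "sets G = sets borel" "emeasure G {0..} = 1" using assms by (auto simp: prior_class_def)
  have "AE \<theta> in G. \<theta> \<in> {0..}"
    using s by (intro AE_prob_1) (simp add: measure_def)
  then show "nonneg_prior G" using s by unfold_locales auto
  show "(\<integral>\<^sup>+u. ennreal (u powr p) \<partial>G) \<le> 1" using assms by (simp add: prior_class_def)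
qed

section \<open>Second moments under the sampling model\<close>

text \<open>The variance of a mean of independent terms, bounded by the raw second moment, which
  centring only decreases.\<close>

lemma iid_mean_square_error:
  fixes g :: "'a \<Rightarrow> real"
  assumes M: "prob_space M" and g [measurable]: "g \<in> borel_measurable M"
    and bd: "\<And>x. \<bar>g x\<bar> \<le> K" and n: "n > 0"
  shows "integrable (Pi\<^sub>M {1..n} (\<lambda>_. M)) (\<lambda>\<omega>. ((\<Sum>i\<in>{1..n}. g (\<omega> i)) / real n - (\<integral>x. g x \<partial>M))\<^sup>2)" (is ?i)
    and "(\<integral>\<omega>. ((\<Sum>i\<in>{1..n}. g (\<omega> i)) / real n - (\<integral>x. g x \<partial>M))\<^sup>2 \<partial>Pi\<^sub>M {1..n} (\<lambda>_. M))
      \<le> (\<integral>x. (g x)\<^sup>2 \<partial>M) / real n" (is ?e)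
proof -
  interpret M: prob_space M by (rule M)
  interpret P: product_prob_space "\<lambda>_. M" "{1..n}" ..
  let ?P = "Pi\<^sub>M {1..n} (\<lambda>_. M)"
  define \<mu> where "\<mu> = (\<integral>x. g x \<partial>M)"
  define h where "h x = g x - \<mu>" for x
  have h [measurable]: "h \<in> borel_measurable M" unfolding h_def[abs_def] by measurable
  have hb: "\<bar>h x\<bar> \<le> K + \<bar>\<mu>\<bar>" for x
    using bd[of x] by (simp add: h_def abs_if split: if_splits)
  have ig: "integrable M g" using bd by (intro M.integrable_const_bound[of _ K]) auto
  have ig2: "integrable M (\<lambda>x. (g x)\<^sup>2)"
    using power_mono[OF bd abs_ge_zero, of _ 2]
    by (intro M.integrable_const_bound[of _ "K\<^sup>2"]) auto
  have ih: "integrable M h" "(\<integral>x. h x \<partial>M) = 0"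
    using ig by (auto simp: h_def[abs_def] \<mu>_def M.prob_space)
  have h2: "(\<lambda>x. (h x)\<^sup>2) = (\<lambda>x. (g x)\<^sup>2 - 2 * \<mu> * g x + \<mu>\<^sup>2)"
    by (auto simp: h_def power2_diff)
  have ih2: "integrable M (\<lambda>x. (h x)\<^sup>2)" unfolding h2 using ig ig2 by simp
  have eh2: "(\<integral>x. (h x)\<^sup>2 \<partial>M) \<le> (\<integral>x. (g x)\<^sup>2 \<partial>M)"
    unfolding h2 using ig ig2 by (simp add: M.prob_space power2_eq_square flip: \<mu>_def)
  have cov: "integrable ?P (\<lambda>\<omega>. h (\<omega> i) * h (\<omega> j)) \<and>
      (\<integral>\<omega>. h (\<omega> i) * h (\<omega> j) \<partial>?P) = (if i = j then \<integral>x. (h x)\<^sup>2 \<partial>M else 0)"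
    if ij: "i \<in> {1..n}" "j \<in> {1..n}" for i j
  proof (cases "i = j")
    case True
    \<comment> \<open>Filling the other coordinates with the factor 1 presents the expectation as
      that of a full product, which integrates coordinatewise.\<close>
    define F where "F k = (if k = i then \<lambda>x. (h x)\<^sup>2 else (\<lambda>_. 1))" for k
    have F: "integrable M (F k)" for k using ih2 by (simp add: F_def)
    have e: "(\<Prod>k\<in>{1..n}. F k (\<omega> k)) = h (\<omega> i) * h (\<omega> j)" for \<omega>
    proof -
      have "(\<Prod>k\<in>{1..n}. F k (\<omega> k)) = (\<Prod>k\<in>{1..n}. if k = i then (h (\<omega> i))\<^sup>2 else 1)"
        by (intro prod.cong) (auto simp: F_def)
      then show ?thesis using ij True by (simp add: power2_eq_square)
    qed
    have "(\<Prod>k\<in>{1..n}. \<integral>x. F k x \<partial>M) = (\<Prod>k\<in>{1..n}. if k = i then (\<integral>x. (h x)\<^sup>2 \<partial>M) else 1)"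
      by (intro prod.cong) (auto simp: F_def M.prob_space)
    then show ?thesis
      using P.product_integral_prod[of "{1..n}" F] P.product_integrable_prod[of "{1..n}" F] F ij True
      by (simp add: e[unfolded One_nat_def])
  next
    case False
    define F where "F k = (if k = i \<or> k = j then h else (\<lambda>_. 1))" for k
    have F: "integrable M (F k)" for k using ih by (simp add: F_def)
    have e: "(\<Prod>k\<in>{1..n}. F k (\<omega> k)) = h (\<omega> i) * h (\<omega> j)" for \<omega>
    proof -
      have "(\<Prod>k\<in>{1..n}. F k (\<omega> k)) = (\<Prod>k\<in>{i,j}. F k (\<omega> k))"
        using ij by (intro prod.mono_neutral_right) (auto simp: F_def)
      then show ?thesis using False by (simp add: F_def)
    qed
    have "(\<integral>x. F i x \<partial>M) = 0" using ih by (simp add: F_def)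
    then have "(\<Prod>k\<in>{1..n}. \<integral>x. F k x \<partial>M) = 0" using ij by (intro prod_zero) auto
    then show ?thesis
      using P.product_integral_prod[of "{1..n}" F] P.product_integrable_prod[of "{1..n}" F] F False
      by (simp add: e[unfolded One_nat_def])
  qed
  have e: "((\<Sum>i\<in>{1..n}. g (\<omega> i)) / real n - \<mu>)\<^sup>2 =
      (\<Sum>i\<in>{1..n}. \<Sum>j\<in>{1..n}. h (\<omega> i) * h (\<omega> j)) / (real n)\<^sup>2" for \<omega>
  proof -
    have "(\<Sum>i\<in>{1..n}. g (\<omega> i)) / real n - \<mu> = (\<Sum>i\<in>{1..n}. h (\<omega> i)) / real n"
      using n by (simp add: h_def sum_subtractf field_simps)
    then show ?thesis by (simp add: power_divide power2_eq_square sum_product)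
  qed
  show ?i unfolding \<mu>_def[symmetric] e using cov by (intro integrable_divide Bochner_Integration.integrable_sum) blast
  have "(\<integral>\<omega>. ((\<Sum>i\<in>{1..n}. g (\<omega> i)) / real n - \<mu>)\<^sup>2 \<partial>?P) =
      (\<Sum>i\<in>{1..n}. \<Sum>j\<in>{1..n}. \<integral>\<omega>. h (\<omega> i) * h (\<omega> j) \<partial>?P) / (real n)\<^sup>2"
  proof -
    have "(\<integral>\<omega>. (\<Sum>j\<in>{1..n}. h (\<omega> i) * h (\<omega> j)) \<partial>?P) = (\<Sum>j\<in>{1..n}. \<integral>\<omega>. h (\<omega> i) * h (\<omega> j) \<partial>?P)"
      if "i \<in> {1..n}" for i
      using cov[OF that] by (intro Bochner_Integration.integral_sum) blast
    moreover have "(\<integral>\<omega>. (\<Sum>i\<in>{1..n}. \<Sum>j\<in>{1..n}. h (\<omega> i) * h (\<omega> j)) \<partial>?P) =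
        (\<Sum>i\<in>{1..n}. \<integral>\<omega>. (\<Sum>j\<in>{1..n}. h (\<omega> i) * h (\<omega> j)) \<partial>?P)"
      using cov by (intro Bochner_Integration.integral_sum Bochner_Integration.integrable_sum) blast
    ultimately show ?thesis unfolding e by simp
  qed
  also have "\<dots> = (\<Sum>i\<in>{1..n}. \<Sum>j\<in>{1..n}. if i = j then \<integral>x. (h x)\<^sup>2 \<partial>M else 0) / (real n)\<^sup>2"
    using cov by (intro arg_cong2[where f="(/)"] sum.cong) auto
  also have "\<dots> = (\<integral>x. (h x)\<^sup>2 \<partial>M) / real n"
    using n by (simp add: power2_eq_square)
  also have "\<dots> \<le> (\<integral>x. (g x)\<^sup>2 \<partial>M) / real n" using eh2 by (intro divide_right_mono) auto
  finally show ?e unfolding \<mu>_def .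
qed

section \<open>The joint law of a parameter and its observation\<close>

context nonneg_prior
begin

lemma sets_poisson_joint: "sets (poisson_joint G) = sets (borel \<Otimes>\<^sub>M count_space UNIV)"
  unfolding poisson_joint_def sets_density by (rule sets_pair_measure_cong[OF sets_G refl])

lemma measurable_poisson_joint:
  "f \<in> measurable (borel \<Otimes>\<^sub>M count_space UNIV) M \<Longrightarrow> f \<in> measurable (poisson_joint G) M"
  by (simp add: measurable_cong_sets[OF sets_poisson_joint])

lemma nn_integral_poisson_joint:
  assumes h: "h \<in> borel_measurable (borel \<Otimes>\<^sub>M count_space UNIV)"
  shows "(\<integral>\<^sup>+z. h z \<partial>poisson_joint G) = (\<integral>\<^sup>+\<theta>. (\<Sum>y. ennreal (poisson_lik \<theta> y) * h (\<theta>, y)) \<partial>G)"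
proof -
  interpret C: sigma_finite_measure "count_space (UNIV :: nat set)"
    by (rule sigma_finite_measure_count_space)
  have s: "sets (G \<Otimes>\<^sub>M count_space (UNIV :: nat set)) = sets (borel \<Otimes>\<^sub>M count_space UNIV)"
    by (rule sets_pair_measure_cong[OF sets_G refl])
  have h' [measurable]: "h \<in> borel_measurable (G \<Otimes>\<^sub>M count_space UNIV)"
    using h by (simp add: measurable_cong_sets[OF s])
  have [measurable]: "(\<lambda>(\<theta>, y). ennreal (poisson_lik \<theta> y)) \<in> borel_measurable (G \<Otimes>\<^sub>M count_space UNIV)"
  proof -
    have "(\<lambda>z. ennreal (poisson_lik (fst z) (snd z))) \<in> borel_measurable (G \<Otimes>\<^sub>M count_space UNIV)"
      by (rule measurable_compose_countable[of "\<lambda>i z. ennreal (poisson_lik (fst z) i)"])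
         (auto simp: poisson_lik_def)
    then show ?thesis unfolding case_prod_unfold .
  qed
  have "(\<integral>\<^sup>+z. h z \<partial>poisson_joint G) =
      (\<integral>\<^sup>+z. (case z of (\<theta>, y) \<Rightarrow> ennreal (poisson_lik \<theta> y)) * h z \<partial>(G \<Otimes>\<^sub>M count_space UNIV))"
    unfolding poisson_joint_def by (rule nn_integral_density) measurable
  also have "\<dots> = (\<integral>\<^sup>+\<theta>. \<integral>\<^sup>+y. ennreal (poisson_lik \<theta> y) * h (\<theta>, y) \<partial>count_space UNIV \<partial>G)"
    by (subst C.nn_integral_fst[symmetric]) auto
  finally show ?thesis by (simp add: nn_integral_count_space_nat)
qed

lemma prob_space_poisson_joint: "prob_space (poisson_joint G)"
proof
  have "emeasure (poisson_joint G) (space (poisson_joint G)) = (\<integral>\<^sup>+z. 1 \<partial>poisson_joint G)" by simp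
  also have "\<dots> = 1" by (subst nn_integral_poisson_joint) (simp_all add: nn_integral_suminf_poisson_lik)
  finally show "emeasure (poisson_joint G) (space (poisson_joint G)) = 1" .
qed

lemma emeasure_poisson_joint:
  assumes [measurable]: "A \<in> sets borel"
  shows "emeasure (poisson_joint G) (A \<times> {y}) = (\<integral>\<^sup>+\<theta>. ennreal (poisson_lik \<theta> y) * indicator A \<theta> \<partial>G)"
proof -
  have [measurable]: "A \<times> {y} \<in> sets (borel \<Otimes>\<^sub>M count_space UNIV)" by simp
  then have "emeasure (poisson_joint G) (A \<times> {y}) = (\<integral>\<^sup>+z. indicator (A \<times> {y}) z \<partial>poisson_joint G)"
    by (simp add: sets_poisson_joint)
  also have "\<dots> = (\<integral>\<^sup>+\<theta>. (\<Sum>y'. ennreal (poisson_lik \<theta> y') * indicator (A \<times> {y}) (\<theta>, y')) \<partial>G)"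
    by (rule nn_integral_poisson_joint) measurable
  also have "\<dots> = (\<integral>\<^sup>+\<theta>. ennreal (poisson_lik \<theta> y) * indicator A \<theta> \<partial>G)"
  proof (rule nn_integral_cong)
    fix \<theta>
    show "(\<Sum>y'. ennreal (poisson_lik \<theta> y') * indicator (A \<times> {y}) (\<theta>, y')) =
        ennreal (poisson_lik \<theta> y) * indicator A \<theta>"
      by (subst suminf_finite[of "{y}"]) (auto simp: indicator_def)
  qed
  finally show ?thesis .
qed

lemma integral_poisson_joint_snd:
  fixes g :: "nat \<Rightarrow> real"
  assumes "finite F" and F: "\<And>y. y \<notin> F \<Longrightarrow> g y = 0"
  shows "(\<integral>z. g (snd z) \<partial>poisson_joint G) = (\<Sum>y\<in>F. g y * poisson_mixture G y)"
proof -
  interpret J: prob_space "poisson_joint G" by (rule prob_space_poisson_joint)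
  have e: "g (snd z) = (\<Sum>y\<in>F. g y * indicator (UNIV \<times> {y}) z)" for z :: "real \<times> nat"
  proof -
    have "(\<Sum>y\<in>F. g y * indicator (UNIV \<times> {y}) z) = (\<Sum>y\<in>F. if y = snd z then g y else 0)"
      by (rule sum.cong) (simp_all add: indicator_def mem_Times_iff)
    also have "\<dots> = (if snd z \<in> F then g (snd z) else 0)"
      using \<open>finite F\<close> by (rule sum.delta)
    also have "\<dots> = g (snd z)" by (simp add: F)
    finally show ?thesis by (rule sym)
  qed
  have s: "UNIV \<times> {y} \<in> sets (poisson_joint G)" for y
    by (simp add: sets_poisson_joint)
  have m: "measure (poisson_joint G) (UNIV \<times> {y}) = poisson_mixture G y" for y
    using emeasure_poisson_joint[of UNIV y] poisson_mixture_nonneg[of y]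
    by (simp add: nn_integral_poisson_lik measure_def)
  show ?thesis unfolding e using s
    by (subst Bochner_Integration.integral_sum)
       (auto simp: m intro!: integrable_mult_right integrable_real_indicator simp: less_top[symmetric])
qed

end

section \<open>Blockwise projection of the empirical distribution\<close>

lemma mem_block_iff: "y \<in> block D k \<longleftrightarrow> floor_sqrt (D\<^sup>2 * y) = k"
proof
  assume "y \<in> block D k"
  then show "floor_sqrt (D\<^sup>2 * y) = k"
    by (intro floor_sqrt_unique) (auto simp: block_def)
next
  assume "floor_sqrt (D\<^sup>2 * y) = k"
  then show "y \<in> block D k"
    using Suc_floor_sqrt_power2_gt[of "D\<^sup>2 * y"] by (auto simp: block_def)
qed

text \<open>A cutoff at a perfect square is a union of whole blocks:
  \<open>floor_sqrt (D\<^sup>2 * y) < D * S\<close> is equivalent to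
  \<open>D\<^sup>2 * y < (D * S)\<^sup>2\<close>.\<close>

lemma sum_blocks:
  fixes h :: "nat \<Rightarrow> real"
  assumes "D > 0"
  shows "(\<Sum>k<D * S. \<Sum>y\<in>block D k. h y) = (\<Sum>y<S\<^sup>2. h y)"
proof -
  have lt: "floor_sqrt (D\<^sup>2 * y) < D * S \<longleftrightarrow> y < S\<^sup>2" for y
  proof -
    have "floor_sqrt (D\<^sup>2 * y) < D * S \<longleftrightarrow> D\<^sup>2 * y < (D * S)\<^sup>2"
      using le_floor_sqrt_iff[of "D * S" "D\<^sup>2 * y"] by linarith
    then show ?thesis using assms by (simp add: power_mult_distrib)
  qed
  have "(\<Sum>y<S\<^sup>2. h y) = (\<Sum>k<D * S. \<Sum>y\<in>{y \<in> {..<S\<^sup>2}. floor_sqrt (D\<^sup>2 * y) = k}. h y)"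
    using lt by (intro sum.group[symmetric]) auto
  also have "\<dots> = (\<Sum>k<D * S. \<Sum>y\<in>block D k. h y)"
  proof (rule sum.cong)
    fix k assume "k \<in> {..<D * S}"
    then have "y \<in> {y \<in> {..<S\<^sup>2}. floor_sqrt (D\<^sup>2 * y) = k} \<longleftrightarrow> y \<in> block D k" for y
      using lt[of y] unfolding mem_block_iff mem_Collect_eq lessThan_iff by blast
    then show "sum h {y \<in> {..<S\<^sup>2}. floor_sqrt (D\<^sup>2 * y) = k} = sum h (block D k)"
      by (intro sum.cong) blast+
  qed simp
  finally show ?thesis by simp
qed

text \<open>The projections of the single blocks are glued into one kernel that vanishes between
  different blocks. The last bound leaves \<open>f\<close> and \<open>c\<close> free because the
  mixture and its coefficients vary with the prior, whereas the kernel must not.\<close>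

lemma block_kernel_exists:
  fixes e :: "nat \<Rightarrow> nat \<Rightarrow> nat \<Rightarrow> real"
  assumes D: "D > 0"
  obtains Q :: "nat \<Rightarrow> nat \<Rightarrow> real" where
    "\<And>y z. floor_sqrt (D\<^sup>2 * z) \<noteq> floor_sqrt (D\<^sup>2 * y) \<Longrightarrow> Q y z = 0"
    "\<And>k. (\<Sum>y\<in>block D k. \<Sum>z\<in>block D k. (Q y z)\<^sup>2) \<le> real m"
    "\<And>k f c. (\<Sum>y\<in>block D k. ((\<Sum>z\<in>block D k. Q y z * f z) - f y)\<^sup>2)
      \<le> (\<Sum>y\<in>block D k. (f y - (\<Sum>j<m. c j * e k j y))\<^sup>2)"
proof -
  have ex: "\<forall>k. \<exists>P. (\<forall>y\<in>block D k. \<forall>z\<in>block D k. P y z = P z y) \<and>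
    (\<forall>y\<in>block D k. \<forall>w\<in>block D k. (\<Sum>z\<in>block D k. P y z * P z w) = P y w) \<and>
    (\<forall>j<m. \<forall>y\<in>block D k. (\<Sum>z\<in>block D k. P y z * e k j z) = e k j y) \<and>
    (\<Sum>y\<in>block D k. P y y) \<le> real m"
    using projection_kernel_exists[OF finite_block[OF D]] by blast
  from choice[OF ex] obtain P where "\<forall>k. (\<forall>y\<in>block D k. \<forall>z\<in>block D k. P k y z = P k z y) \<and>
    (\<forall>y\<in>block D k. \<forall>w\<in>block D k. (\<Sum>z\<in>block D k. P k y z * P k z w) = P k y w) \<and>
    (\<forall>j<m. \<forall>y\<in>block D k. (\<Sum>z\<in>block D k. P k y z * e k j z) = e k j y) \<and>
    (\<Sum>y\<in>block D k. P k y y) \<le> real m" ..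
  note P = spec[OF this]
  define Q where "Q y z = (if floor_sqrt (D\<^sup>2 * z) = floor_sqrt (D\<^sup>2 * y)
    then P (floor_sqrt (D\<^sup>2 * y)) y z else 0)" for y z
  have Q: "Q y z = P k y z" if "y \<in> block D k" "z \<in> block D k" for k y z
    using that by (simp add: Q_def mem_block_iff)
  show ?thesis
  proof (rule that[of Q])
    fix k
    have "(\<Sum>y\<in>block D k. \<Sum>z\<in>block D k. (Q y z)\<^sup>2) = (\<Sum>y\<in>block D k. \<Sum>z\<in>block D k. (P k y z)\<^sup>2)"
      by (intro sum.cong refl) (simp add: Q)
    also have "\<dots> = (\<Sum>y\<in>block D k. P k y y)"
      using P[of k] by (intro projection_kernel_sum_squares) auto
    finally show "(\<Sum>y\<in>block D k. \<Sum>z\<in>block D k. (Q y z)\<^sup>2) \<le> real m" using P[of k] by simp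
  next
    fix k :: nat and f c :: "nat \<Rightarrow> real"
    have "(\<Sum>y\<in>block D k. ((\<Sum>z\<in>block D k. Q y z * f z) - f y)\<^sup>2) =
        (\<Sum>y\<in>block D k. ((\<Sum>z\<in>block D k. P k y z * f z) - f y)\<^sup>2)"
      by (intro sum.cong refl arg_cong2[where f="\<lambda>a b. (a - b)\<^sup>2"]) (simp add: Q)
    also have "\<dots> \<le> (\<Sum>y\<in>block D k. (f y - (\<Sum>j<m. c j * e k j y))\<^sup>2)"
    proof (rule projection_kernel_residual)
      fix y assume y: "y \<in> block D k"
      have "(\<Sum>z\<in>block D k. P k y z * (\<Sum>j<m. c j * e k j z)) =
          (\<Sum>j<m. c j * (\<Sum>z\<in>block D k. P k y z * e k j z))"
        unfolding sum_distrib_left by (subst sum.swap) (simp add: mult_ac)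
      moreover have "(\<Sum>z\<in>block D k. P k y z * e k j z) = e k j y" if "j < m" for j
        using P[of k] y that by blast
      ultimately show "(\<Sum>z\<in>block D k. P k y z * (\<Sum>j<m. c j * e k j z)) = (\<Sum>j<m. c j * e k j y)"
        by simp
    qed (use P[of k] in auto)
    finally show "(\<Sum>y\<in>block D k. ((\<Sum>z\<in>block D k. Q y z * f z) - f y)\<^sup>2)
      \<le> (\<Sum>y\<in>block D k. (f y - (\<Sum>j<m. c j * e k j y))\<^sup>2)" .
  qed (simp add: Q_def)
qed

text \<open>The kernel applied to the empirical frequencies, written as an average over the sample.
  Its values may be negative, hence the later \<open>max 0\<close>.\<close>

definition smoothed :: "(nat \<Rightarrow> nat \<Rightarrow> real) \<Rightarrow> nat \<Rightarrow> (nat \<Rightarrow> nat) \<Rightarrow> nat \<Rightarrow> real" where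
  "smoothed Q n x y = (\<Sum>i\<in>{1..n}. Q y (x i)) / real n"

lemma smoothed_observations:
  "smoothed Q n (observations n \<omega>) y = (\<Sum>i\<in>{1..n}. Q y (snd (\<omega> i))) / real n"
  by (simp add: smoothed_def observations_def)

context nonneg_prior
begin

lemma smoothed_mean_square_error:
  assumes B: "finite B" and Q: "\<And>z. z \<notin> B \<Longrightarrow> Q y z = 0" and n: "n > 0"
  defines "\<mu> \<equiv> \<Sum>z\<in>B. Q y z * poisson_mixture G z"
  shows "integrable (eb_model n G) (\<lambda>\<omega>. (smoothed Q n (observations n \<omega>) y - \<mu>)\<^sup>2)"
    and "(\<integral>\<omega>. (smoothed Q n (observations n \<omega>) y - \<mu>)\<^sup>2 \<partial>eb_model n G)
      \<le> (\<Sum>z\<in>B. (Q y z)\<^sup>2 * poisson_mixture G z) / real n"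
proof -
  have bd: "\<bar>Q y (snd z)\<bar> \<le> (\<Sum>w\<in>B. \<bar>Q y w\<bar>)" for z :: "real \<times> nat"
    using B Q[of "snd z"] by (cases "snd z \<in> B") (auto simp: sum_nonneg intro: member_le_sum)
  have m: "(\<lambda>z. Q y (snd z)) \<in> borel_measurable (poisson_joint G)"
    by (rule measurable_poisson_joint) measurable
  have \<mu>: "(\<integral>z. Q y (snd z) \<partial>poisson_joint G) = \<mu>"
    unfolding \<mu>_def using B Q by (rule integral_poisson_joint_snd)
  have v: "(\<integral>z. (Q y (snd z))\<^sup>2 \<partial>poisson_joint G) = (\<Sum>z\<in>B. (Q y z)\<^sup>2 * poisson_mixture G z)"
    using B by (rule integral_poisson_joint_snd) (simp add: Q)
  show "integrable (eb_model n G) (\<lambda>\<omega>. (smoothed Q n (observations n \<omega>) y - \<mu>)\<^sup>2)"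
    using iid_mean_square_error(1)[OF prob_space_poisson_joint m bd n]
    unfolding smoothed_observations eb_model_def \<mu> .
  show "(\<integral>\<omega>. (smoothed Q n (observations n \<omega>) y - \<mu>)\<^sup>2 \<partial>eb_model n G)
      \<le> (\<Sum>z\<in>B. (Q y z)\<^sup>2 * poisson_mixture G z) / real n"
    using iid_mean_square_error(2)[OF prob_space_poisson_joint m bd n]
    unfolding smoothed_observations eb_model_def \<mu> v .
qed

lemma prob_space_eb_model: "prob_space (eb_model n G)"
  unfolding eb_model_def by (intro prob_space_PiM prob_space_poisson_joint)

text \<open>The error is weighted by \<open>w = 1 / (f + \<tau>)\<close> and split at the mean
  \<open>\<mu>\<close>. Variance: comparability within a block cancels \<open>w y\<close> against
  \<open>f z\<close> up to the factor 8, leaving the squared entries of the kernel, whose sum is at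
  most \<open>m\<close>. Bias: at most \<open>\<tau>\<close> per point, on average over a block.
  This gives \<open>4 * 8 * m / n\<close> for each of the \<open>D * S\<close> blocks and
  \<open>5 * \<tau>\<close> for each of the \<open>S\<^sup>2\<close> points.\<close>

lemma smoothed_sqrt_risk:
  assumes D: "real D = 24 * L" and L: "L \<ge> 1" and m: "m > 0" and n: "n > 0"
    and \<tau>: "\<tau> > 0" "2 * (1/2) ^ m + exp (- (L - 1)\<^sup>2) \<le> \<tau>"
    and Q1: "\<And>y z. floor_sqrt (D\<^sup>2 * z) \<noteq> floor_sqrt (D\<^sup>2 * y) \<Longrightarrow> Q y z = 0"
    and Q2: "\<And>k. (\<Sum>y\<in>block D k. \<Sum>z\<in>block D k. (Q y z)\<^sup>2) \<le> real m"
    and Q3: "\<And>k f c. (\<Sum>y\<in>block D k. ((\<Sum>z\<in>block D k. Q y z * f z) - f y)\<^sup>2)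
      \<le> (\<Sum>y\<in>block D k. (f y - (\<Sum>j<m. c j * block_basis D k j y))\<^sup>2)"
  shows "(\<integral>\<^sup>+\<omega>. ennreal (\<Sum>y<S\<^sup>2. (sqrt (max 0 (smoothed Q n (observations n \<omega>) y)) -
      sqrt (poisson_mixture G y))\<^sup>2) \<partial>eb_model n G)
    \<le> ennreal (32 * real m * real (D * S) / real n + 5 * \<tau> * real (S\<^sup>2))"
proof -
  interpret E: prob_space "eb_model n G" by (rule prob_space_eb_model)
  have D0: "D > 0" using D L by (cases D) auto
  define f where "f = poisson_mixture G"
  have f0: "f y \<ge> 0" for y by (simp add: f_def poisson_mixture_nonneg)
  define B where "B y = block D (floor_sqrt (D\<^sup>2 * y))" for y
  have Bk: "B y = block D k" if "y \<in> block D k" for y k using that by (simp add: B_def mem_block_iff)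
  have finB: "finite (B y)" for y unfolding B_def by (rule finite_block[OF D0])
  have QB: "Q y z = 0" if "z \<notin> B y" for y z
    using that by (intro Q1) (simp add: B_def mem_block_iff)
  define \<mu> where "\<mu> y = (\<Sum>z\<in>B y. Q y z * f z)" for y
  define w where "w y = 1 / (f y + \<tau>)" for y
  have w: "w y > 0" "w y \<le> 1 / \<tau>" for y
    using f0[of y] \<tau> by (auto simp: w_def frac_le add_nonneg_pos)
  define X where "X y \<omega> = (smoothed Q n (observations n \<omega>) y - \<mu> y)\<^sup>2" for y \<omega>
  have X: "integrable (eb_model n G) (X y)"
    "(\<integral>\<omega>. X y \<omega> \<partial>eb_model n G) \<le> (\<Sum>z\<in>B y. (Q y z)\<^sup>2 * f z) / real n" for y
    using smoothed_mean_square_error[where Q=Q and y=y, OF finB[of y] QB n]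
    by (simp_all add: X_def[abs_def] \<mu>_def f_def)
  \<comment> \<open>The factor 4 combines the 2 of \<open>sqrt_diff_sq_le\<close> with the 2 of
    \<open>(u + v)^2 \<le> 2 * u^2 + 2 * v^2\<close>.\<close>
  define Z where "Z \<omega> = (\<Sum>y<S\<^sup>2. 4 * w y * X y \<omega> + (4 * w y * (\<mu> y - f y)\<^sup>2 + \<tau>))" for \<omega>
  have pt: "(\<Sum>y<S\<^sup>2. (sqrt (max 0 (smoothed Q n (observations n \<omega>) y)) - sqrt (f y))\<^sup>2) \<le> Z \<omega>" for \<omega>
    unfolding Z_def
  proof (rule sum_mono)
    fix y
    define s where "s = smoothed Q n (observations n \<omega>) y"
    have "(s - f y)\<^sup>2 \<le> 2 * (s - \<mu> y)\<^sup>2 + 2 * (\<mu> y - f y)\<^sup>2"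
      using sum_squares_bound[of "s - \<mu> y" "\<mu> y - f y"]
        power2_sum[of "s - \<mu> y" "\<mu> y - f y"] by simp
    then have "2 * w y * (s - f y)\<^sup>2 \<le> 2 * w y * (2 * (s - \<mu> y)\<^sup>2 + 2 * (\<mu> y - f y)\<^sup>2)"
      using w[of y] by (intro mult_left_mono) auto
    then show "(sqrt (max 0 (smoothed Q n (observations n \<omega>) y)) - sqrt (f y))\<^sup>2
        \<le> 4 * w y * X y \<omega> + (4 * w y * (\<mu> y - f y)\<^sup>2 + \<tau>)"
      using sqrt_diff_sq_le[OF f0[of y] \<tau>(1), of s]
      by (simp add: X_def w_def s_def distrib_left)
  qed
  have iZ: "integrable (eb_model n G) Z" unfolding Z_def[abs_def] using X by simp
  have Z0: "Z \<omega> \<ge> 0" for \<omega>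
    by (rule order_trans[OF _ pt]) (simp add: sum_nonneg)
  define Y where "Y y = 4 * w y * ((\<Sum>z\<in>B y. (Q y z)\<^sup>2 * f z) / real n)
    + (4 * w y * (\<mu> y - f y)\<^sup>2 + \<tau>)" for y
  have "(\<integral>\<omega>. Z \<omega> \<partial>eb_model n G) =
      (\<Sum>y<S\<^sup>2. 4 * w y * (\<integral>\<omega>. X y \<omega> \<partial>eb_model n G) + (4 * w y * (\<mu> y - f y)\<^sup>2 + \<tau>))"
    unfolding Z_def using X by (simp add: E.prob_space)
  also have "\<dots> \<le> (\<Sum>y<S\<^sup>2. Y y)"
    unfolding Y_def using X(2) w(1) by (intro sum_mono add_right_mono mult_left_mono) (auto simp: less_imp_le)
  also have "\<dots> = (\<Sum>k<D * S. \<Sum>y\<in>block D k. Y y)" using sum_blocks[OF D0] by simp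
  also have "\<dots> \<le> (\<Sum>k<D * S. 32 * real m / real n + (\<Sum>y\<in>block D k. 5 * \<tau>))"
  proof (rule sum_mono)
    fix k
    have var: "(\<Sum>y\<in>block D k. w y * (\<Sum>z\<in>B y. (Q y z)\<^sup>2 * f z)) \<le> 8 * real m"
    proof -
      have "(\<Sum>y\<in>block D k. w y * (\<Sum>z\<in>B y. (Q y z)\<^sup>2 * f z))
          \<le> (\<Sum>y\<in>block D k. \<Sum>z\<in>block D k. 8 * (Q y z)\<^sup>2)"
      proof (rule sum_mono)
        fix y assume y: "y \<in> block D k"
        have "w y * ((Q y z)\<^sup>2 * f z) \<le> 8 * (Q y z)\<^sup>2" if z: "z \<in> block D k" for z
        proof -
          have "f z \<le> 8 * f y + exp (- (L - 1)\<^sup>2)"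
            unfolding f_def by (rule poisson_mixture_block_comparable[OF y z D L])
          also have "exp (- (L - 1)\<^sup>2) \<le> \<tau>"
            using \<tau>(2) zero_le_power[of "1/2::real" m] by linarith
          also have "8 * f y + \<tau> \<le> 8 * (f y + \<tau>)" using \<tau> by simp
          finally have "w y * f z \<le> 8" using f0[of y] \<tau> by (simp add: w_def divide_le_eq)
          then have "(Q y z)\<^sup>2 * (w y * f z) \<le> (Q y z)\<^sup>2 * 8" by (intro mult_left_mono) auto
          then show ?thesis by (simp add: mult_ac)
        qed
        then show "w y * (\<Sum>z\<in>B y. (Q y z)\<^sup>2 * f z) \<le> (\<Sum>z\<in>block D k. 8 * (Q y z)\<^sup>2)"
          unfolding Bk[OF y] sum_distrib_left by (intro sum_mono)
      qed
      also have "\<dots> \<le> 8 * real m" using Q2[of k] by (simp flip: sum_distrib_left)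
      finally show ?thesis .
    qed
    have bias: "(\<Sum>y\<in>block D k. w y * (\<mu> y - f y)\<^sup>2) \<le> (\<Sum>y\<in>block D k. \<tau>)"
    proof -
      obtain c where c: "\<And>y. y \<in> block D k \<Longrightarrow> \<bar>f y - (\<Sum>j<m. c j * block_basis D k j y)\<bar> \<le> 2 * (1/2) ^ m + exp (- (L - 1)\<^sup>2)"
        (is "\<And>y. _ \<Longrightarrow> \<bar>f y - ?q c y\<bar> \<le> _")
        using poisson_mixture_block_approx[OF D L m, of k] unfolding f_def by blast
      \<comment> \<open>A constant weight lets the unweighted residual bound apply. The crude
        \<open>1 / \<tau>\<close> is affordable because the approximation error is at most
        \<open>\<tau>\<close> pointwise and enters squared.\<close>
      have "(\<Sum>y\<in>block D k. w y * (\<mu> y - f y)\<^sup>2) \<le> (\<Sum>y\<in>block D k. 1 / \<tau> * (\<mu> y - f y)\<^sup>2)"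
        using w by (intro sum_mono mult_right_mono) auto
      also have "\<dots> = 1 / \<tau> * (\<Sum>y\<in>block D k. ((\<Sum>z\<in>block D k. Q y z * f z) - f y)\<^sup>2)"
        unfolding sum_distrib_left by (intro sum.cong) (simp_all add: \<mu>_def Bk)
      also have "\<dots> \<le> 1 / \<tau> * (\<Sum>y\<in>block D k. (f y - ?q c y)\<^sup>2)"
        using \<tau> by (intro mult_left_mono Q3) auto
      also have "\<dots> \<le> 1 / \<tau> * (\<Sum>y\<in>block D k. \<tau>\<^sup>2)"
      proof (intro mult_left_mono sum_mono)
        fix y assume "y \<in> block D k"
        then have "\<bar>f y - ?q c y\<bar> \<le> \<bar>\<tau>\<bar>" using c \<tau> by fastforce
        then show "(f y - ?q c y)\<^sup>2 \<le> \<tau>\<^sup>2" by (rule abs_le_square_iff[THEN iffD1])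
      qed (use \<tau> in auto)
      also have "\<dots> = (\<Sum>y\<in>block D k. \<tau>)" using \<tau> by (simp add: power2_eq_square)
      finally show ?thesis .
    qed
    have "Y y = 4 / real n * (w y * (\<Sum>z\<in>B y. (Q y z)\<^sup>2 * f z)) + 4 * (w y * (\<mu> y - f y)\<^sup>2) + \<tau>" for y
      by (simp add: Y_def)
    then have "(\<Sum>y\<in>block D k. Y y) = 4 / real n * (\<Sum>y\<in>block D k. w y * (\<Sum>z\<in>B y. (Q y z)\<^sup>2 * f z))
        + 4 * (\<Sum>y\<in>block D k. w y * (\<mu> y - f y)\<^sup>2) + (\<Sum>y\<in>block D k. \<tau>)"
      by (simp only: sum.distrib sum_distrib_left[symmetric])
    also have "\<dots> \<le> 4 / real n * (8 * real m) + 4 * (\<Sum>y\<in>block D k. \<tau>) + (\<Sum>y\<in>block D k. \<tau>)"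
      using var bias n by (intro add_mono mult_left_mono) auto
    also have "\<dots> = 32 * real m / real n + (\<Sum>y\<in>block D k. 5 * \<tau>)" by simp
    finally show "(\<Sum>y\<in>block D k. Y y) \<le> 32 * real m / real n + (\<Sum>y\<in>block D k. 5 * \<tau>)" .
  qed
  also have "\<dots> = 32 * real m * real (D * S) / real n + 5 * \<tau> * real (S\<^sup>2)"
    unfolding sum.distrib sum_blocks[OF D0] by simp
  finally have bound: "(\<integral>\<omega>. Z \<omega> \<partial>eb_model n G) \<le>
    32 * real m * real (D * S) / real n + 5 * \<tau> * real (S\<^sup>2)" .
  have "(\<integral>\<^sup>+\<omega>. ennreal (\<Sum>y<S\<^sup>2. (sqrt (max 0 (smoothed Q n (observations n \<omega>) y)) -
      sqrt (poisson_mixture G y))\<^sup>2) \<partial>eb_model n G) \<le> (\<integral>\<^sup>+\<omega>. ennreal (Z \<omega>) \<partial>eb_model n G)"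
    using pt by (intro nn_integral_mono ennreal_leI) (simp add: f_def)
  also have "\<dots> = ennreal (\<integral>\<omega>. Z \<omega> \<partial>eb_model n G)"
    using iZ Z0 by (intro nn_integral_eq_integral) auto
  finally show ?thesis using bound by (meson ennreal_leI order_trans)
qed

end

section \<open>The perturbed estimator\<close>

text \<open>Adding \<open>\<eta>\<close> costs a factor 2; from \<open>N\<close> on,
  \<open>b\<close> vanishes and the loss is \<open>f\<close> itself, which sums to the tail.
  Normalising doubles everything.\<close>

lemma hellinger_sq_estimate_le:
  fixes b \<eta> f :: "nat \<Rightarrow> real"
  assumes b: "\<And>y. b y \<ge> 0" "\<And>y. y \<ge> N \<Longrightarrow> b y = 0"
    and \<eta>: "\<And>y. \<eta> y > 0" "summable \<eta>" and f: "\<And>y. f y \<ge> 0" "f sums 1"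
  shows "hellinger_sq (\<lambda>y. (b y + \<eta> y) / (\<Sum>y. b y + \<eta> y)) f
    \<le> 4 * (\<Sum>y<N. (sqrt (b y) - sqrt (f y))\<^sup>2) + 4 * (1 - (\<Sum>y<N. f y)) + 4 * suminf \<eta>"
proof -
  have sb: "summable b" using b(2) by (intro summable_finite[of "{..<N}"]) auto
  have sa: "summable (\<lambda>y. b y + \<eta> y)" using sb \<eta> by (intro summable_add)
  have a0: "b y + \<eta> y > 0" for y using b(1)[of y] \<eta>(1)[of y] by simp
  have fs: "summable f" "suminf f = 1" using f by (auto simp: sums_iff)
  define g where "g y = (if y < N then (sqrt (b y) - sqrt (f y))\<^sup>2 else 0)" for y
  define t where "t y = (if y < N then 0 else f y)" for y
  have g: "g sums (\<Sum>y<N. (sqrt (b y) - sqrt (f y))\<^sup>2)"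
    using sums_If_finite_set[of "{..<N}" "\<lambda>y. (sqrt (b y) - sqrt (f y))\<^sup>2"] by (simp add: g_def[abs_def])
  have "(\<lambda>y. if y < N then f y else 0) sums (\<Sum>y<N. f y)"
    using sums_If_finite_set[of "{..<N}" f] by simp
  from sums_diff[OF f(2) this] have t: "t sums (1 - (\<Sum>y<N. f y))"
    by (rule sums_cong[THEN iffD1, rotated]) (simp add: t_def)
  have "(\<lambda>y. 2 * g y + 2 * t y + 2 * \<eta> y) sums
      (2 * (\<Sum>y<N. (sqrt (b y) - sqrt (f y))\<^sup>2) + 2 * (1 - (\<Sum>y<N. f y)) + 2 * suminf \<eta>)"
    by (intro sums_add sums_mult g t summable_sums \<eta>)
  note R = this[THEN sums_summable] this[THEN sums_unique]
  have "hellinger_sq (\<lambda>y. b y + \<eta> y) f \<le> (\<Sum>y. 2 * g y + 2 * t y + 2 * \<eta> y)"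
    unfolding hellinger_sq_def
  proof (rule suminf_le)
    fix y
    have "(sqrt (b y + \<eta> y) - sqrt (f y))\<^sup>2 \<le> 2 * (sqrt (b y) - sqrt (f y))\<^sup>2 + 2 * \<eta> y"
      using b(1) \<eta>(1) by (intro sqrt_add_diff_sq_le) (auto simp: less_imp_le)
    also have "\<dots> \<le> 2 * g y + 2 * t y + 2 * \<eta> y"
      using b(2)[of y] f(1)[of y] by (auto simp: g_def t_def not_less)
    finally show "(sqrt (b y + \<eta> y) - sqrt (f y))\<^sup>2 \<le> 2 * g y + 2 * t y + 2 * \<eta> y" .
  qed (use R summable_sqrt_diff_sq(1)[OF less_imp_le[OF a0] f(1) sa fs(1)] in auto)
  moreover have "hellinger_sq (\<lambda>y. (b y + \<eta> y) / (\<Sum>y. b y + \<eta> y)) f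
      \<le> 2 * hellinger_sq (\<lambda>y. b y + \<eta> y) f"
    using a0 by (intro hellinger_sq_normalise sa f suminf_pos) (auto simp: less_imp_le)
  ultimately show ?thesis using R(2) by simp
qed

text \<open>Shrinking the value at the single point \<open>N\<close> by the factor \<open>\<rho>\<close> blows up the ratio of the values
  at \<open>N + 1\<close> and \<open>N\<close> at no cost in total mass.\<close>

definition perturbation :: "real \<Rightarrow> real \<Rightarrow> nat \<Rightarrow> nat \<Rightarrow> real" where
  "perturbation \<sigma> \<rho> N y = \<sigma> * (1/2) ^ Suc y * (if y = N then \<rho> else 1)"

text \<open>At \<open>N\<close> and \<open>N + 1\<close> only the perturbation is present, so the
  ratio of the two values is exactly \<open>1 / (2 * \<rho>)\<close> for every sample. Its
  positivity everywhere also makes the denominator of the estimator nonzero.\<close>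

definition unnormalised :: "(nat \<Rightarrow> nat \<Rightarrow> real) \<Rightarrow> real \<Rightarrow> real \<Rightarrow> nat \<Rightarrow> nat \<Rightarrow> (nat \<Rightarrow> nat) \<Rightarrow> nat \<Rightarrow> real" where
  "unnormalised Q \<sigma> \<rho> N n x y =
    (if y < N then max 0 (smoothed Q n x y) else 0) + perturbation \<sigma> \<rho> N y"

definition block_estimator :: "(nat \<Rightarrow> nat \<Rightarrow> real) \<Rightarrow> real \<Rightarrow> real \<Rightarrow> nat \<Rightarrow> nat \<Rightarrow> (nat \<Rightarrow> nat) \<Rightarrow> nat pmf" where
  "block_estimator Q \<sigma> \<rho> N n x =
    embed_pmf (\<lambda>y. unnormalised Q \<sigma> \<rho> N n x y / suminf (unnormalised Q \<sigma> \<rho> N n x))"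

context
  fixes Q :: "nat \<Rightarrow> nat \<Rightarrow> real" and \<sigma> \<rho> :: real and N n :: nat
  assumes \<sigma>: "\<sigma> > 0" and \<rho>: "0 < \<rho>" "\<rho> \<le> 1"
begin

lemma perturbation_pos: "perturbation \<sigma> \<rho> N y > 0"
  using \<sigma> \<rho> by (simp add: perturbation_def)

lemma perturbation_summable: "summable (perturbation \<sigma> \<rho> N)" "suminf (perturbation \<sigma> \<rho> N) \<le> \<sigma>"
proof -
  have s: "(\<lambda>y. \<sigma> * (1/2) ^ Suc y) sums (\<sigma> * 1)"
    by (intro sums_mult power_half_series)
  have le: "perturbation \<sigma> \<rho> N y \<le> \<sigma> * (1/2) ^ Suc y" for y
    using \<sigma> \<rho> mult_left_mono[OF \<rho>(2), of "\<sigma> * (1/2) ^ Suc y"] by (simp add: perturbation_def)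
  show 1: "summable (perturbation \<sigma> \<rho> N)"
    by (rule summable_comparison_test_ev[OF _ sums_summable[OF s]])
       (use le perturbation_pos in \<open>auto simp: less_imp_le abs_of_pos intro!: always_eventually\<close>)
  show "suminf (perturbation \<sigma> \<rho> N) \<le> \<sigma>"
    using suminf_le[OF le 1 sums_summable[OF s]] sums_unique[OF s] by simp
qed

lemma unnormalised_pos: "unnormalised Q \<sigma> \<rho> N n x y > 0"
  unfolding unnormalised_def using perturbation_pos by (auto intro: add_nonneg_pos)

lemma unnormalised_sums:
  "unnormalised Q \<sigma> \<rho> N n x sums
    ((\<Sum>y<N. max 0 (smoothed Q n x y)) + suminf (perturbation \<sigma> \<rho> N))"
proof -
  have "(\<lambda>y. if y < N then max 0 (smoothed Q n x y) else 0) sums (\<Sum>y<N. max 0 (smoothed Q n x y))"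
    using sums_If_finite_set[of "{..<N}" "\<lambda>y. max 0 (smoothed Q n x y)"] by simp
  from sums_add[OF this summable_sums[OF perturbation_summable(1)]]
  show ?thesis by (simp add: unnormalised_def[abs_def])
qed

lemma suminf_unnormalised_pos: "suminf (unnormalised Q \<sigma> \<rho> N n x) > 0"
  using unnormalised_sums unnormalised_pos by (intro suminf_pos) (auto simp: sums_iff)

lemma pmf_block_estimator:
  "pmf (block_estimator Q \<sigma> \<rho> N n x) y =
    unnormalised Q \<sigma> \<rho> N n x y / suminf (unnormalised Q \<sigma> \<rho> N n x)"
  unfolding block_estimator_def
proof (rule pmf_embed_pmf)
  let ?u = "unnormalised Q \<sigma> \<rho> N n x"
  show nn: "0 \<le> ?u y / suminf ?u" for y
    using unnormalised_pos suminf_unnormalised_pos by (simp add: less_imp_le)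
  have "summable ?u" using unnormalised_sums by (simp add: sums_iff)
  then have "(\<lambda>y. ?u y / suminf ?u) sums (suminf ?u / suminf ?u)"
    by (intro sums_divide summable_sums)
  then have "(\<lambda>y. ?u y / suminf ?u) sums 1"
    using suminf_unnormalised_pos[of x] by simp
  from suminf_ennreal_eq[OF nn this]
  show "(\<integral>\<^sup>+y. ennreal (?u y / suminf ?u) \<partial>count_space UNIV) = 1"
    by (simp add: nn_integral_count_space_nat)
qed

lemma random_pmf_block_estimator: "random_pmf n (block_estimator Q \<sigma> \<rho> N n)"
proof -
  have [measurable]: "(\<lambda>x. smoothed Q n x y) \<in> borel_measurable (observation_space n)" for y
    unfolding smoothed_def observation_space_def
    by (intro borel_measurable_divide borel_measurable_sum) (auto intro!: measurable_compose[OF measurable_component_singleton])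
  have e: "suminf (unnormalised Q \<sigma> \<rho> N n x) =
    (\<Sum>y<N. max 0 (smoothed Q n x y)) + suminf (perturbation \<sigma> \<rho> N)" for x
    using sums_unique[OF unnormalised_sums] by simp
  show ?thesis
    unfolding random_pmf_def pmf_block_estimator e unnormalised_def by measurable
qed

lemma f_modeling_well_defined_block_estimator:
  "f_modeling_well_defined n (block_estimator Q \<sigma> \<rho> N n)"
  unfolding f_modeling_well_defined_def pmf_block_estimator
  using unnormalised_pos suminf_unnormalised_pos by (simp add: less_imp_neq[symmetric])

lemma f_modeling_block_estimator:
  assumes "x n = N"
  shows "f_modeling n (block_estimator Q \<sigma> \<rho> N n) x \<ge> 1 / (2 * \<rho>)"
proof -
  have "f_modeling n (block_estimator Q \<sigma> \<rho> N n) x = (real N + 1) * (1 / (2 * \<rho>))"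
    unfolding f_modeling_def pmf_block_estimator assms
    using suminf_unnormalised_pos[of x] \<sigma> \<rho>
    by (simp add: unnormalised_def perturbation_def field_simps)
  also have "\<dots> \<ge> 1 * (1 / (2 * \<rho>))" using \<rho> by (intro mult_right_mono) auto
  finally show ?thesis by simp
qed

text \<open>The perturbation enters through its mass alone, which is at most
  \<open>\<sigma>\<close>; the bound is therefore uniform in \<open>\<rho>\<close>.\<close>

lemma hellinger_risk_block_estimator:
  assumes G: "nonneg_prior G"
    and r: "(\<integral>\<^sup>+\<omega>. ennreal (\<Sum>y<N. (sqrt (max 0 (smoothed Q n (observations n \<omega>) y)) -
      sqrt (poisson_mixture G y))\<^sup>2) \<partial>eb_model n G) \<le> ennreal r0" and r0: "r0 \<ge> 0"
  shows "hellinger_risk n (block_estimator Q \<sigma> \<rho> N n) G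
    \<le> ennreal (4 * r0 + 4 * (1 - (\<Sum>y<N. poisson_mixture G y)) + 4 * \<sigma>)"
proof -
  interpret nonneg_prior G by (rule G)
  interpret E: prob_space "eb_model n G" by (rule prob_space_eb_model)
  define f where "f = poisson_mixture G"
  define T where "T = 4 * (1 - (\<Sum>y<N. f y)) + 4 * \<sigma>"
  define W where "W \<omega> = (\<Sum>y<N. (sqrt (max 0 (smoothed Q n (observations n \<omega>) y)) - sqrt (f y))\<^sup>2)" for \<omega>
  have f: "f y \<ge> 0" "f sums 1" for y
    by (auto simp: f_def poisson_mixture_nonneg poisson_mixture_sums)
  have "(\<Sum>y<N. f y) \<le> 1" using sum_le_suminf[of f "{..<N}"] f by (auto simp: sums_iff)
  then have T0: "T \<ge> 0" using \<sigma> by (simp add: T_def)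
  have W0: "W \<omega> \<ge> 0" for \<omega> by (simp add: W_def sum_nonneg)
  have h: "hellinger_sq (pmf (block_estimator Q \<sigma> \<rho> N n (observations n \<omega>))) f \<le> 4 * W \<omega> + T" for \<omega>
  proof -
    define b where "b y = (if y < N then max 0 (smoothed Q n (observations n \<omega>) y) else 0)" for y
    have "hellinger_sq (\<lambda>y. (b y + perturbation \<sigma> \<rho> N y) / (\<Sum>y. b y + perturbation \<sigma> \<rho> N y)) f
        \<le> 4 * (\<Sum>y<N. (sqrt (b y) - sqrt (f y))\<^sup>2) + 4 * (1 - (\<Sum>y<N. f y))
          + 4 * suminf (perturbation \<sigma> \<rho> N)"
      by (rule hellinger_sq_estimate_le)
        (auto simp: b_def perturbation_pos perturbation_summable(1) f)
    then show ?thesis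
      using perturbation_summable(2)
      unfolding pmf_block_estimator[abs_def] unnormalised_def[abs_def] b_def by (simp add: W_def T_def)
  qed
  have mW: "W \<in> borel_measurable (eb_model n G)"
  proof -
    have "(\<lambda>\<omega>. Q y (snd (\<omega> i))) \<in> borel_measurable (eb_model n G)" if "i \<in> {1..n}" for i y
    proof -
      have "(\<lambda>z. Q y (snd z)) \<in> borel_measurable (poisson_joint G)"
        by (rule measurable_poisson_joint) measurable
      then show ?thesis
        unfolding eb_model_def by (rule measurable_compose[OF measurable_component_singleton[OF that]])
    qed
    then have "(\<lambda>\<omega>. smoothed Q n (observations n \<omega>) y) \<in> borel_measurable (eb_model n G)" for y
      unfolding smoothed_observations by (intro borel_measurable_divide borel_measurable_sum) auto
    then show ?thesis unfolding W_def[abs_def] by simp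
  qed
  have "hellinger_risk n (block_estimator Q \<sigma> \<rho> N n) G \<le> (\<integral>\<^sup>+\<omega>. 4 * ennreal (W \<omega>) + ennreal T \<partial>eb_model n G)"
    unfolding hellinger_risk_def f_def[symmetric]
  proof (rule nn_integral_mono)
    fix \<omega>
    have "4 * ennreal (W \<omega>) + ennreal T = ennreal (4 * W \<omega> + T)"
      using W0 T0 by (simp add: ennreal_mult)
    then show "ennreal (hellinger_sq (pmf (block_estimator Q \<sigma> \<rho> N n (observations n \<omega>))) f)
        \<le> 4 * ennreal (W \<omega>) + ennreal T"
      using h[of \<omega>] by (simp add: ennreal_leI)
  qed
  also have "\<dots> = 4 * (\<integral>\<^sup>+\<omega>. ennreal (W \<omega>) \<partial>eb_model n G) + ennreal T"
    using mW by (simp add: nn_integral_add nn_integral_cmult E.emeasure_space_1)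
  also have "\<dots> \<le> 4 * ennreal r0 + ennreal T"
    using r by (intro add_right_mono mult_left_mono) (auto simp: W_def f_def)
  also have "\<dots> = ennreal (4 * r0 + T)" using r0 T0 by (simp add: ennreal_mult)
  finally show ?thesis by (simp add: T_def f_def add.assoc)
qed

end

section \<open>The regret under the point mass at 1\<close>

lemma nonneg_prior_return: "c \<ge> 0 \<Longrightarrow> nonneg_prior (return borel c)"
  by (intro nonneg_prior.intro prob_space_return nonneg_prior_axioms.intro) (auto simp: AE_return)

lemma return_in_prior_class: "return borel 1 \<in> prior_class p"
  by (auto simp: prior_class_def prob_space_return nn_integral_return)

lemma AE_poisson_joint_return: "AE z in poisson_joint (return borel 1). fst z = 1"
proof -
  interpret nonneg_prior "return borel 1" by (rule nonneg_prior_return) simp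
  define h :: "real \<times> nat \<Rightarrow> ennreal" where "h = indicator {z. fst z \<noteq> 1}"
  have h: "h \<in> borel_measurable (borel \<Otimes>\<^sub>M count_space UNIV)" unfolding h_def by measurable
  have "(\<integral>\<^sup>+z. h z \<partial>poisson_joint (return borel 1)) =
      (\<integral>\<^sup>+\<theta>. (\<Sum>y. ennreal (poisson_lik \<theta> y) * h (\<theta>, y)) \<partial>return borel 1)"
    by (rule nn_integral_poisson_joint[OF h])
  also have "\<dots> = (\<Sum>y. ennreal (poisson_lik 1 y) * h (1, y))"
    using h by (intro nn_integral_return) (auto simp: poisson_lik_def)
  also have "\<dots> = 0" by (simp add: h_def)
  finally have "AE z in poisson_joint (return borel 1). h z = 0"
    using measurable_poisson_joint[OF h] by (subst (asm) nn_integral_0_iff_AE) auto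
  then show ?thesis by eventually_elim (auto simp: h_def indicator_def split: if_splits)
qed

text \<open>\<open>fst\<close> is not a function of the observation, but it agrees almost surely
  with the constant 1, which is; so the posterior mean is 1 almost surely.\<close>

lemma mmse_return: "mmse (return borel 1) = 0"
proof -
  interpret nonneg_prior "return borel 1" by (rule nonneg_prior_return) simp
  define J where "J = poisson_joint (return borel 1)"
  define F where "F = vimage_algebra (space J) (snd :: real \<times> nat \<Rightarrow> nat) (count_space UNIV)"
  interpret J: prob_space J unfolding J_def by (rule prob_space_poisson_joint)
  have snd: "(snd :: real \<times> nat \<Rightarrow> nat) \<in> measurable J (count_space UNIV)"
    unfolding J_def by (rule measurable_poisson_joint) measurable
  have "subalgebra J F"
    unfolding subalgebra_def F_def using sets_image_in_sets[OF refl snd] by simp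
  then interpret finite_measure_subalgebra J F
    by unfold_locales
  have AE1: "AE z in J. fst z = 1" unfolding J_def by (rule AE_poisson_joint_return)
  have "fst \<in> borel_measurable J" unfolding J_def by (rule measurable_poisson_joint) measurable
  then have "AE z in J. real_cond_exp J F fst z = real_cond_exp J F (\<lambda>_. 1) z"
    by (rule real_cond_exp_cong[OF AE1]) simp
  moreover have "AE z in J. real_cond_exp J F (\<lambda>_. 1) z = 1"
    by (rule real_cond_exp_F_meas) auto
  moreover note AE1
  ultimately have "AE z in J. ennreal ((posterior_mean (return borel 1) z - fst z)\<^sup>2) = 0"
    unfolding posterior_mean_def J_def[symmetric] F_def[symmetric]
    by eventually_elim simp
  then show ?thesis
    unfolding mmse_def J_def[symmetric] by (subst nn_integral_cong_AE[of _ "\<lambda>_. 0"]) auto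
qed

text \<open>The integral is restricted to the event that the last pair is \<open>(1, N)\<close>, of
  probability \<open>poisson_lik 1 N\<close>. There the error is at least \<open>X\<close>, the
  parameter 1 being subtracted from \<open>1 + X\<close>.\<close>

lemma risk_return_ge:
  assumes n: "n > 0" and X: "X \<ge> 0" and est: "\<And>x. x n = N \<Longrightarrow> est x \<ge> 1 + X"
  shows "risk n est (return borel 1) \<ge> ennreal (X\<^sup>2 * poisson_lik 1 N)"
proof -
  interpret nonneg_prior "return borel 1" by (rule nonneg_prior_return) simp
  define J where "J = poisson_joint (return borel 1)"
  let ?P = "eb_model n (return borel 1)"
  have nI: "n \<in> {1..n}" using n by simp
  have sJ: "{1} \<times> {N} \<in> sets J"
    unfolding J_def sets_poisson_joint by (intro pair_measureI) auto
  have pj: "(\<lambda>\<omega>. \<omega> n) \<in> measurable ?P J"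
    unfolding eb_model_def J_def using nI by (rule measurable_component_singleton)
  define A where "A = (\<lambda>\<omega>. \<omega> n) -` ({1} \<times> {N}) \<inter> space ?P"
  have A: "A \<in> sets ?P" unfolding A_def using pj sJ by (rule measurable_sets)
  have "emeasure ?P A = emeasure (distr ?P J (\<lambda>\<omega>. \<omega> n)) ({1} \<times> {N})"
    unfolding A_def using pj sJ by (simp add: emeasure_distr)
  also have "distr ?P J (\<lambda>\<omega>. \<omega> n) = J"
    unfolding eb_model_def J_def[symmetric]
    by (rule distr_PiM_component) (use nI prob_space_poisson_joint in \<open>auto simp: J_def\<close>)
  also have "emeasure J ({1} \<times> {N}) = ennreal (poisson_lik 1 N)"
    unfolding J_def by (subst emeasure_poisson_joint)
      (auto simp: nn_integral_return poisson_lik_def[abs_def])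
  finally have eA: "emeasure ?P A = ennreal (poisson_lik 1 N)" .
  have "ennreal (X\<^sup>2 * poisson_lik 1 N) = (\<integral>\<^sup>+\<omega>. ennreal (X\<^sup>2) * indicator A \<omega> \<partial>?P)"
    using A by (simp add: nn_integral_cmult_indicator eA ennreal_mult poisson_lik_nonneg)
  also have "\<dots> \<le> risk n est (return borel 1)"
    unfolding risk_def
  proof (rule nn_integral_mono)
    fix \<omega>
    show "ennreal (X\<^sup>2) * indicator A \<omega> \<le> ennreal ((est (observations n \<omega>) - fst (\<omega> n))\<^sup>2)"
    proof (cases "\<omega> \<in> A")
      case True
      then have "\<omega> n = (1, N)" by (auto simp: A_def)
      moreover have "observations n \<omega> n = snd (\<omega> n)" using nI by (simp add: observations_def)
      ultimately have "X \<le> est (observations n \<omega>) - fst (\<omega> n)" using est[of "observations n \<omega>"] by simp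
      then have "X\<^sup>2 \<le> (est (observations n \<omega>) - fst (\<omega> n))\<^sup>2" using X by (intro power_mono) auto
      then show ?thesis using True by (simp add: ennreal_leI)
    qed simp
  qed
  finally show ?thesis .
qed

section \<open>Rates\<close>

lemma ln_2_ge_half: "ln (2::real) \<ge> 1/2"
proof -
  have "exp (1/2::real) \<le> 2" using exp_bound_half[of "1/2::real"] by simp
  then show ?thesis using ln_ge_iff[of "2::real" "1/2"] by linarith
qed

text \<open>With \<open>L = m = 2 * k + 2\<close> this brings the error from outside the window down
  to the truncation error \<open>2 * 2^-m\<close>, so that together they are at most
  \<open>2^(-2 * k)\<close>.\<close>

lemma exp_le_half_power: "exp (- ((real (2 * k + 2) - 1)\<^sup>2)) \<le> (1/2) ^ (2 * k + 1)"
proof -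
  have "exp (-1::real) \<le> 1/2"
    using exp_ge_add_one_self[of "1::real"] by (simp add: exp_minus field_simps)
  then have "exp (-1::real) ^ (2 * k + 1) \<le> (1/2) ^ (2 * k + 1)" by (intro power_mono) auto
  moreover have "exp (-1::real) ^ (2 * k + 1) = exp (- real (2 * k + 1))"
    by (simp only: exp_of_nat_mult[symmetric] mult_minus1_right)
  moreover have "real (2 * k + 1) * 1 \<le> real (2 * k + 1) * real (2 * k + 1)"
    by (intro mult_left_mono) auto
  then have "exp (- ((real (2 * k + 1))\<^sup>2)) \<le> exp (- real (2 * k + 1))"
    unfolding power2_eq_square exp_le_cancel_iff by (simp only: mult_1_right neg_le_iff_le)
  then have "exp (- ((real (2 * k + 2) - 1)\<^sup>2)) \<le> exp (- real (2 * k + 1))"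
    by simp
  ultimately show ?thesis by linarith
qed

text \<open>Kernel and cutoff are produced before \<open>\<rho>\<close> and \<open>G\<close> are
  quantified; the lower bound relies on this order, since its \<open>\<rho>\<close> depends on
  \<open>N\<close>.\<close>

lemma hellinger_rate_estimator:
  fixes p :: real
  assumes p: "p > 0" and n: "n \<ge> 2"
  defines "C \<equiv> 16 * 1572864 + 64 * (84 + 4 * (4 powr p + (4 * p) powr p))"
  obtains Q N where "\<And>\<rho> G. 0 < \<rho> \<Longrightarrow> \<rho> \<le> 1 \<Longrightarrow> G \<in> prior_class p \<Longrightarrow>
    hellinger_risk n (block_estimator Q (1 / real n) \<rho> N n) G
      \<le> ennreal (C * real n powr (- (2 * p / (2 * p + 1))) * ln (real n) ^ 6)"
proof -
  define l where "l = ln (real n)"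
  \<comment> \<open>\<open>X\<close> is the square root of the intended cutoff: it solves
    \<open>X / n = X^(-2 * p)\<close>, the balance of variance against tail mass, and both sides
    equal \<open>r\<close>.\<close>
  define X where "X = real n powr (1 / (2 * p + 1))"
  define r where "r = real n powr (- (2 * p / (2 * p + 1)))"
  define S where "S = nat \<lceil>X\<rceil>"
  \<comment> \<open>\<open>2^k \<ge> n\<close> makes the approximation error
    \<open>2^(-2 * k)\<close> at most \<open>\<tau> = 1 / n^2\<close>.\<close>
  define k where "k = nat \<lceil>log 2 (real n)\<rceil>"
  define m where "m = 2 * k + 2"
  define L where "L = real (2 * k + 2)"
  define D where "D = 24 * (2 * k + 2)"
  define \<tau> where "\<tau> = 1 / (real n)\<^sup>2"
  define C0 where "C0 = 4 powr p + (4 * p) powr p"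
  have n0: "real n > 0" "real n \<ge> 2" using n by auto
  have l: "l \<ge> 1/2"
    using order_trans[OF ln_2_ge_half ln_mono[of 2 "real n"]] n0 by (simp add: l_def)
  have r: "r > 0" using n0 by (simp add: r_def)
  have Xr: "X / real n = r"
  proof -
    have "1 / (2 * p + 1) - 1 = - (2 * p / (2 * p + 1))" using p by (simp add: field_simps)
    then have "r = real n powr (1 / (2 * p + 1) - 1)" by (simp add: r_def)
    also have "\<dots> = X / real n" using n0 by (simp add: powr_diff X_def)
    finally show ?thesis by simp
  qed
  have X1: "X \<ge> 1" unfolding X_def using n0 p by (intro ge_one_powr_ge_zero) auto
  have Xn: "X \<le> real n"
    using powr_mono[of "1 / (2 * p + 1)" 1 "real n"] n0 p by (simp add: X_def)
  have S: "X \<le> real S" "real S \<le> 2 * X"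
    using X1 by (auto simp: S_def) linarith
  have lg: "log 2 (real n) \<ge> 1" using n0 by (simp add: le_log_iff)
  have k: "log 2 (real n) \<le> real k" "real k \<le> 4 * l"
  proof -
    show "log 2 (real n) \<le> real k" using lg by (simp add: k_def)
    have "real k \<le> 2 * log 2 (real n)" using lg by (simp add: k_def) linarith
    also have "log 2 (real n) \<le> 2 * l"
      using ln_2_ge_half l mult_left_mono[OF ln_2_ge_half, of "2 * l"]
      by (simp add: log_def l_def divide_le_eq)
    finally show "real k \<le> 4 * l" by simp
  qed
  have k1: "real k \<ge> 1" using k lg by linarith
  have nk: "real n \<le> 2 ^ k"
    using k(1) n0 by (simp add: log_le_iff powr_realpow)
  have \<tau>0: "\<tau> > 0" using n0 by (simp add: \<tau>_def)
  have \<tau>: "2 * (1/2) ^ m + exp (- (L - 1)\<^sup>2) \<le> \<tau>"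
  proof -
    have "2 * (1/2) ^ m = (1/2::real) ^ (2 * k + 1)" by (simp add: m_def)
    moreover have "exp (- (L - 1)\<^sup>2) \<le> (1/2) ^ (2 * k + 1)"
      unfolding L_def by (rule exp_le_half_power)
    moreover have "(1/2::real) ^ (2 * k + 1) + (1/2) ^ (2 * k + 1) = 1 / (2 ^ k)\<^sup>2"
      by (simp add: power_divide flip: power_mult)
    moreover have "\<dots> \<le> \<tau>"
      unfolding \<tau>_def using nk n0 by (intro divide_left_mono power_mono) auto
    ultimately show ?thesis by linarith
  qed
  have DL: "real D = 24 * L" by (simp add: D_def L_def)
  have L1: "L \<ge> 1" by (simp add: L_def)
  have m0: "m > 0" and D0: "D > 0" by (simp_all add: m_def D_def)
  obtain Q :: "nat \<Rightarrow> nat \<Rightarrow> real" where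
    Q: "\<And>y z. floor_sqrt (D\<^sup>2 * z) \<noteq> floor_sqrt (D\<^sup>2 * y) \<Longrightarrow> Q y z = 0"
    "\<And>k. (\<Sum>y\<in>block D k. \<Sum>z\<in>block D k. (Q y z)\<^sup>2) \<le> real m"
    "\<And>k f c. (\<Sum>y\<in>block D k. ((\<Sum>z\<in>block D k. Q y z * f z) - f y)\<^sup>2)
      \<le> (\<Sum>y\<in>block D k. (f y - (\<Sum>j<m. c j * block_basis D k j y))\<^sup>2)"
    by (rule block_kernel_exists[OF D0, where m=m and e="block_basis D"], rule that)
  define r0 where "r0 = 32 * real m * real (D * S) / real n + 5 * \<tau> * real (S\<^sup>2)"
  have Sn: "real S / real n \<le> 2 * r"
    using divide_right_mono[OF S(2), of "real n"] n0 Xr by simp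
  have var: "32 * real m * real (D * S) / real n \<le> 393216 * l\<^sup>2 * r"
  proof -
    have "real m * real D = 24 * (2 * real k + 2)\<^sup>2"
      by (simp add: m_def D_def power2_eq_square algebra_simps)
    \<comment> \<open>\<open>2 * k + 2 \<le> 4 * k \<le> 16 * l\<close>, from
      \<open>k \<ge> 1\<close> and \<open>k \<le> 4 * l\<close>. The constant of the variance is
      then \<open>393216 = 32 * 24 * 16^2 * 2\<close>.\<close>
    also have "\<dots> \<le> 24 * (16 * l)\<^sup>2"
      using k k1 by (intro mult_left_mono power_mono) auto
    finally have mD: "real m * real D \<le> 6144 * l\<^sup>2" by (simp add: power_mult_distrib)
    have "32 * real m * real (D * S) / real n = 32 * (real m * real D) * (real S / real n)"
      by simp
    also have "\<dots> \<le> 32 * (6144 * l\<^sup>2) * (2 * r)"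
      by (rule mult_mono[OF mult_left_mono[OF mD] Sn]) auto
    finally show ?thesis by simp
  qed
  have bias: "5 * \<tau> * real (S\<^sup>2) \<le> 20 * r"
  proof -
    have "\<tau> * real (S\<^sup>2) = (real S / real n)\<^sup>2" by (simp add: \<tau>_def power_divide)
    also have "\<dots> \<le> (2 * r)\<^sup>2" using Sn n0 by (intro power_mono) auto
    also have "\<dots> \<le> 4 * r"
    proof -
      have "r \<le> 1" using Xr Xn n0 by (metis divide_le_eq_1_pos)
      then show ?thesis using r by (simp add: power2_eq_square mult_left_le)
    qed
    finally show ?thesis by simp
  qed
  \<comment> \<open>\<open>1572864 = 4 * 393216\<close>, and \<open>84 = 4 * 20 + 4\<close> collects
    the bias and the perturbation of mass at most \<open>1 / n \<le> r\<close>.\<close>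
  have "4 * r0 + 4 * (C0 * r) + 4 * (1 / real n) \<le> (1572864 * l\<^sup>2 + (84 + 4 * C0)) * r"
  proof -
    have "1 / real n \<le> r" using X1 n0 Xr divide_right_mono[OF X1, of "real n"] by simp
    moreover have "r0 \<le> 393216 * l\<^sup>2 * r + 20 * r" unfolding r0_def using var bias by (rule add_mono)
    moreover have "(1572864 * l\<^sup>2 + (84 + 4 * C0)) * r = 4 * (393216 * l\<^sup>2 * r) + 84 * r + 4 * (C0 * r)"
      by (simp add: algebra_simps)
    ultimately show ?thesis by linarith
  qed
  \<comment> \<open>A bound of order \<open>l^2\<close> is raised to the stated power of the
    logarithm; \<open>l \<ge> 1 / 2\<close> gives \<open>1 \<le> 16 * l^4\<close> and
    \<open>1 \<le> 64 * l^6\<close>, so this also holds for small \<open>n\<close>.\<close>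
  also have "\<dots> \<le> (1572864 * (16 * l ^ 6) + (84 + 4 * C0) * (64 * l ^ 6)) * r"
  proof (intro mult_right_mono add_mono mult_left_mono)
    have "(1/2) ^ 4 \<le> l ^ 4" "(1/2) ^ 6 \<le> l ^ 6" using l by (auto intro!: power_mono)
    then have l4: "1 \<le> 16 * l ^ 4" and l6: "1 \<le> 64 * l ^ 6" by (simp_all add: power_divide)
    have "l\<^sup>2 * 1 \<le> l\<^sup>2 * (16 * l ^ 4)" using l4 by (intro mult_left_mono) auto
    also have "l\<^sup>2 * (16 * l ^ 4) = 16 * l ^ 6" by (simp add: eval_nat_numeral)
    finally show "l\<^sup>2 \<le> 16 * l ^ 6" by simp
    have "(84 + 4 * C0) * 1 \<le> (84 + 4 * C0) * (64 * l ^ 6)"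
      using l6 by (intro mult_left_mono) (auto simp: C0_def)
    then show "84 + 4 * C0 \<le> (84 + 4 * C0) * (64 * l ^ 6)" by simp
  qed (use r in auto)
  also have "\<dots> = C * r * l ^ 6" by (simp add: C_def C0_def algebra_simps)
  finally have total: "4 * r0 + 4 * (C0 * r) + 4 * (1 / real n) \<le> C * r * l ^ 6" .
  have S0: "S\<^sup>2 > 0" using S X1 by (cases S) auto
  show ?thesis
  proof (rule that)
    fix \<rho> :: real and G
    assume \<rho>: "0 < \<rho>" "\<rho> \<le> 1" and G: "G \<in> prior_class p"
    interpret nonneg_prior G using prior_classD(1)[OF G] .
    have "1 - (\<Sum>y<S\<^sup>2. poisson_mixture G y) \<le> C0 * real (S\<^sup>2) powr (-p)"
      unfolding C0_def by (rule poisson_mixture_tail_le[OF p S0 prior_classD(2)[OF G]])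
    also have "\<dots> \<le> C0 * r"
    proof (intro mult_left_mono)
      have "real (S\<^sup>2) powr (-p) \<le> (X\<^sup>2) powr (-p)"
        using S X1 p by (intro powr_mono2') (auto intro!: power_mono)
      also have "\<dots> = X powr (- 2 * p)" using X1 by (simp add: powr_powr flip: powr_numeral)
      also have "\<dots> = r" by (simp add: X_def r_def powr_powr)
      finally show "real (S\<^sup>2) powr (-p) \<le> r" .
    qed (simp add: C0_def)
    finally have tail: "1 - (\<Sum>y<S\<^sup>2. poisson_mixture G y) \<le> C0 * r" .
    have "hellinger_risk n (block_estimator Q (1 / real n) \<rho> (S\<^sup>2) n) G
      \<le> ennreal (4 * r0 + 4 * (1 - (\<Sum>y<S\<^sup>2. poisson_mixture G y)) + 4 * (1 / real n))"
    proof (rule hellinger_risk_block_estimator)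
      show "(\<integral>\<^sup>+\<omega>. ennreal (\<Sum>y<S\<^sup>2. (sqrt (max 0 (smoothed Q n (observations n \<omega>) y)) -
        sqrt (poisson_mixture G y))\<^sup>2) \<partial>eb_model n G) \<le> ennreal r0"
        unfolding r0_def using n by (intro smoothed_sqrt_risk[OF DL L1 m0 _ \<tau>0 \<tau>] Q) auto
      show "r0 \<ge> 0" using \<tau>0 by (simp add: r0_def)
    qed (use n0 \<rho> in \<open>auto intro: nonneg_prior_axioms\<close>)
    also have "\<dots> \<le> ennreal (C * r * l ^ 6)"
    proof (rule ennreal_leI)
      have "4 * r0 + 4 * (1 - (\<Sum>y<S\<^sup>2. poisson_mixture G y)) + 4 * (1 / real n)
          \<le> 4 * r0 + 4 * (C0 * r) + 4 * (1 / real n)"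
        using tail by (intro add_right_mono add_left_mono mult_left_mono) auto
      then show "4 * r0 + 4 * (1 - (\<Sum>y<S\<^sup>2. poisson_mixture G y)) + 4 * (1 / real n) \<le> C * r * l ^ 6"
        using total by (rule order_trans)
    qed
    finally show "hellinger_risk n (block_estimator Q (1 / real n) \<rho> (S\<^sup>2) n) G
      \<le> ennreal (C * real n powr (- (2 * p / (2 * p + 1))) * ln (real n) ^ 6)"
      by (simp add: r_def l_def)
  qed
qed

theorem theorem7:
  fixes p :: real
  assumes "p > 1"
  shows "\<exists>C c :: real. C > 0 \<and> c > 0 \<and>
    (\<forall>\<delta> > 0. \<forall>n \<ge> 2. \<exists>ft :: (nat \<Rightarrow> nat) \<Rightarrow> nat pmf.
       random_pmf n ft \<and> f_modeling_well_defined n ft \<and>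
       (SUP G\<in>prior_class p. hellinger_risk n ft G)
         \<le> ennreal (C * real n powr (- (2 * p / (2 * p + 1))) * ln (real n) ^ 6) \<and>
       regret n (f_modeling n ft) (prior_class p)
         \<ge> ereal (c * real n powr (- ((2 * p - 3) / (2 * p + 1)) - \<delta>) / ln (real n) ^ 4))"
proof -
  define C where "C = 16 * 1572864 + 64 * (84 + 4 * (4 powr p + (4 * p) powr p))"
  have "C > 0" unfolding C_def by (intro add_pos_nonneg) auto
  moreover have "\<exists>ft :: (nat \<Rightarrow> nat) \<Rightarrow> nat pmf.
       random_pmf n ft \<and> f_modeling_well_defined n ft \<and>
       (SUP G\<in>prior_class p. hellinger_risk n ft G)
         \<le> ennreal (C * real n powr (- (2 * p / (2 * p + 1))) * ln (real n) ^ 6) \<and>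
       regret n (f_modeling n ft) (prior_class p)
         \<ge> ereal (1 * real n powr (- ((2 * p - 3) / (2 * p + 1)) - \<delta>) / ln (real n) ^ 4)"
    if n: "n \<ge> 2" for \<delta> :: real and n :: nat
  proof -
    define T where "T = 1 * real n powr (- ((2 * p - 3) / (2 * p + 1)) - \<delta>) / ln (real n) ^ 4"
    have T: "T \<ge> 0" by (simp add: T_def)
    have "p > 0" using assms by simp
    from hellinger_rate_estimator[OF this n, folded C_def] obtain Q N where
      H: "\<And>\<rho> G. 0 < \<rho> \<Longrightarrow> \<rho> \<le> 1 \<Longrightarrow> G \<in> prior_class p \<Longrightarrow>
        hellinger_risk n (block_estimator Q (1 / real n) \<rho> N n) G
          \<le> ennreal (C * real n powr (- (2 * p / (2 * p + 1))) * ln (real n) ^ 6)" by blast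
    define q where "q = poisson_lik 1 N"
    have q: "q > 0" by (simp add: q_def poisson_lik_def)
    \<comment> \<open>\<open>q\<close> is the probability of observing \<open>N\<close> under the
      point mass at 1. The summand \<open>T / q\<close> makes \<open>X * q \<ge> T\<close>, and the
      summand 1 ensures \<open>X \<ge> 1\<close>, hence \<open>X^2 \<ge> X\<close>.\<close>
    define X where "X = 1 + T / q"
    have X: "X \<ge> 1" using T q by (simp add: X_def)
    \<comment> \<open>Solves \<open>1 / (2 * \<rho>) = 1 + X\<close>, so that the estimate at
      \<open>Y\<^sub>n = N\<close> exceeds the true parameter 1 by at least
      \<open>X\<close>.\<close>
    define \<rho> where "\<rho> = 1 / (2 * (1 + X))"
    have \<rho>: "0 < \<rho>" "\<rho> \<le> 1" and \<rho>X: "1 / (2 * \<rho>) = 1 + X" using X by (auto simp: \<rho>_def)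
    have \<sigma>: "1 / real n > 0" using n by simp
    define ft where "ft = block_estimator Q (1 / real n) \<rho> N n"
    have "risk n (f_modeling n ft) (return borel 1) \<ge> ennreal (X\<^sup>2 * q)"
      unfolding q_def
    proof (rule risk_return_ge)
      fix x :: "nat \<Rightarrow> nat"
      assume "x n = N"
      then show "f_modeling n ft x \<ge> 1 + X"
        unfolding ft_def \<rho>X[symmetric] by (rule f_modeling_block_estimator[OF \<sigma> \<rho>])
    qed (use n X in auto)
    moreover have "T \<le> X\<^sup>2 * q"
    proof -
      have "T \<le> X * q" using q by (simp add: X_def distrib_right)
      also have "X * q \<le> X\<^sup>2 * q" using X q by (intro mult_right_mono) (auto simp: power2_eq_square)
      finally show ?thesis .
    qed
    ultimately have "ennreal T \<le> risk n (f_modeling n ft) (return borel 1)"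
      by (meson ennreal_leI order_trans)
    then have "enn2ereal (ennreal T) \<le> enn2ereal (risk n (f_modeling n ft) (return borel 1))"
      by (simp add: less_eq_ennreal.rep_eq)
    then have "ereal T \<le> enn2ereal (risk n (f_modeling n ft) (return borel 1))
        - enn2ereal (mmse (return borel 1))"
      using T by (simp add: mmse_return zero_ennreal.rep_eq enn2ereal_ennreal)
    also have "\<dots> \<le> regret n (f_modeling n ft) (prior_class p)"
      unfolding regret_def using return_in_prior_class by (rule SUP_upper)
    finally have "ereal T \<le> regret n (f_modeling n ft) (prior_class p)" .
    moreover have "(SUP G\<in>prior_class p. hellinger_risk n ft G)
         \<le> ennreal (C * real n powr (- (2 * p / (2 * p + 1))) * ln (real n) ^ 6)"
      unfolding ft_def using H[OF \<rho>] by (rule SUP_least)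
    moreover have "random_pmf n ft" "f_modeling_well_defined n ft"
      unfolding ft_def
      by (rule random_pmf_block_estimator[OF \<sigma> \<rho>] f_modeling_well_defined_block_estimator[OF \<sigma> \<rho>])+
    ultimately show ?thesis unfolding T_def by blast
  qed
  ultimately show ?thesis by (intro exI[of _ C] exI[of _ 1]) simp
qed

end
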